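(* Let $\Gamma$ be a connected compact metric graph and let $\Omega\subset\Gamma$ be measurable with $0<\ell(\Omega)<\ell(\Gamma)$. Then $$h_1^\Gamma(\Omega)=\Lambda_1^\Gamma(\Omega),$$ where $$\Lambda_1^\Gamma(\Omega)=\inf\left\{\frac{TV_\Gamma(u)}{\int_\Gamma u\,dx} : u\in BV(\Gamma),\ u=0 \text{ in } \Gamma\setminus\Omega,\ u\ge 0,\ u\not\equiv 0,\ TV_\Gamma(u)>0\right\}.$$
   Context: $\Gamma$ is a connected compact metric graph: it has finitely many vertices $V(\Gamma)$ and edges $E(\Gamma)$, no loops and no multiple edges; each edge $e$ is identified with an interval $[0,\ell_e]$, $0<\ell_e<\infty$, its initial vertex $i_e$ corresponding to $0$ and its terminal vertex $f_e$ to $\ell_e$. $E_v(\Gamma)$ is the set of edges incident to the vertex $v$. A function $u$ on $\Gamma$ is a collection of functions $[u]_e$ on $(0,\ell_e)$, $e\in E(\Gamma)$; $\int_\Gamma u\,dx=\sum_e\int_0^{\ell_e}[u]_e\,dx$. $L^p(\Gamma)$, $W^{1,p}(\Gamma)$, $BV(\Gamma)$ consist of the $u$ with $[u]_e$ in $L^p(0,\ell_e)$, $W^{1,p}(0,\ell_e)$, $BV(0,\ell_e)$ for every $e$ (no continuity at vertices is required); $u'$ is the edgewise weak derivative. For $A\subset\Gamma$ measurable, $\ell(A)=\int_\Gamma \chi_A\,dx$. For $z\in W^{1,2}(\Gamma)$ and $e\in E_v(\Gamma)$ put $[z]_e(v)=[z]_e(\ell_e)$ if $v=f_e$ and $[z]_e(v)=-[z]_e(0)$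 if $v=i_e$. Let $X_K(\Gamma)=\{z\in W^{1,2}(\Gamma): \sum_{e\in E_v(\Gamma)}[z]_e(v)=0\ \forall v\in V(\Gamma)\}$. The total variation is $TV_\Gamma(u)=\sup\{|\int_\Gamma u z'\,dx| : z\in X_K(\Gamma),\ \|z\|_{L^\infty(\Gamma)}\le 1\}$ (value in $[0,+\infty]$ for $u\in L^1(\Gamma)$), and $\mathrm{Per}_\Gamma(E)=TV_\Gamma(\chi_E)$. The $\Gamma$-Cheeger constant of $\Omega$ is $h_1^\Gamma(\Omega)=\inf\{\mathrm{Per}_\Gamma(E)/\ell(E) : E\subset\Omega \text{ measurable},\ \ell(E)>0\}$. The constant $\Lambda_1^\Gamma(\Omega)$ equals, by homogeneity, the infimum of $TV_\Gamma(u)$ over the same $u$ normalized by $\int_\Gamma u\,dx=1$. *)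

theory Defs
  imports
    "HOL-Analysis.Analysis"
    "HOL-Probability.Essential_Supremum"
    "Graph_Theory.Digraph_Component"
begin

section \<open>Compact metric graphs\<close>

text \<open>
  The arc \<open>e\<close> is identified with an interval of length \<open>len e\<close>; \<open>tail G e\<close> is the initial vertex
  (coordinate \<open>0\<close>) and \<open>head G e\<close> the terminal one (coordinate \<open>len e\<close>). Orientation is only a
  parametrization: connectedness is that of the underlying undirected graph, and multiple edges
  are excluded irrespective of their orientation (\<open>nomulti_digraph\<close> would allow antiparallel arcs).
\<close>

locale connected_metric_graph = fin_digraph G + loopfree_digraph G
  for G :: "('v, 'e) pre_digraph" and len :: "'e \<Rightarrow> real" +
  assumes no_multi_edges: "inj_on (\<lambda>e. {tail G e, head G e}) (arcs G)"
    and len_pos: "e \<in> arcs G \<Longrightarrow> 0 < len e"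
    and connected: "Digraph_Component.connected G"

definition incident_edges :: "('v, 'e) pre_digraph \<Rightarrow> 'v \<Rightarrow> 'e set" where
  "incident_edges G v = in_arcs G v \<union> out_arcs G v"

text \<open>
  Points of the graph are pairs of an edge and an interior coordinate; the finitely many vertices
  form a null set and are left out. A function on the graph is a family \<open>u\<close> with \<open>u e\<close> living on
  the open interval from \<open>0\<close> to \<open>len e\<close>. Measurability is Lebesgue measurability, and functions
  are meant up to null sets.
\<close>

definition points :: "('v, 'e) pre_digraph \<Rightarrow> ('e \<Rightarrow> real) \<Rightarrow> ('e \<times> real) set" where
  "points G len = (SIGMA e:arcs G. {0<..<len e})"

abbreviation edge_measure :: "real \<Rightarrow> real measure" where
  "edge_measure L \<equiv> lebesgue_on {0<..<L}"

definition graph_measurable ::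
    "('v, 'e) pre_digraph \<Rightarrow> ('e \<Rightarrow> real) \<Rightarrow> ('e \<times> real) set \<Rightarrow> bool" where
  "graph_measurable G len A \<longleftrightarrow>
     A \<subseteq> points G len \<and> (\<forall>e\<in>arcs G. {x. (e, x) \<in> A} \<in> sets lebesgue)"

definition graph_integral ::
    "('v, 'e) pre_digraph \<Rightarrow> ('e \<Rightarrow> real) \<Rightarrow> ('e \<Rightarrow> real \<Rightarrow> real) \<Rightarrow> real" where
  "graph_integral G len u = (\<Sum>e\<in>arcs G. integral\<^sup>L (edge_measure (len e)) (u e))"

definition graph_AE ::
    "('v, 'e) pre_digraph \<Rightarrow> ('e \<Rightarrow> real) \<Rightarrow> ('e \<Rightarrow> real \<Rightarrow> bool) \<Rightarrow> bool" where
  "graph_AE G len P \<longleftrightarrow> (\<forall>e\<in>arcs G. AE x in edge_measure (len e). P e x)"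

definition char_fun :: "('e \<times> real) set \<Rightarrow> 'e \<Rightarrow> real \<Rightarrow> real" where
  "char_fun A e x = indicator A (e, x)"

definition graph_length ::
    "('v, 'e) pre_digraph \<Rightarrow> ('e \<Rightarrow> real) \<Rightarrow> ('e \<times> real) set \<Rightarrow> real" where
  "graph_length G len A = graph_integral G len (char_fun A)"

section \<open>Function spaces on an interval\<close>

text \<open>
  Test functions: \<open>C\<^sup>1\<close> with support a (closed, hence compact) subset of the open interval.
\<close>

definition test_fun :: "real \<Rightarrow> (real \<Rightarrow> real) \<Rightarrow> bool" where
  "test_fun L \<phi> \<longleftrightarrow> \<phi> C1_differentiable_on UNIV \<and> closure {x. \<phi> x \<noteq> 0} \<subseteq> {0<..<L}"

definition L2_fun :: "real \<Rightarrow> (real \<Rightarrow> real) \<Rightarrow> bool" where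
  "L2_fun L f \<longleftrightarrow> f \<in> borel_measurable (edge_measure L) \<and> integrable (edge_measure L) (\<lambda>x. (f x)\<^sup>2)"

definition is_weak_deriv :: "real \<Rightarrow> (real \<Rightarrow> real) \<Rightarrow> (real \<Rightarrow> real) \<Rightarrow> bool" where
  "is_weak_deriv L f g \<longleftrightarrow>
     integrable (edge_measure L) f \<and> integrable (edge_measure L) g \<and>
     (\<forall>\<phi>. test_fun L \<phi> \<longrightarrow>
        integral\<^sup>L (edge_measure L) (\<lambda>x. f x * deriv \<phi> x) =
        - integral\<^sup>L (edge_measure L) (\<lambda>x. g x * \<phi> x))"

text \<open>The choice below is unique up to null sets.\<close>

definition weak_deriv :: "real \<Rightarrow> (real \<Rightarrow> real) \<Rightarrow> real \<Rightarrow> real" where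
  "weak_deriv L f = (SOME g. is_weak_deriv L f g)"

definition W12_fun :: "real \<Rightarrow> (real \<Rightarrow> real) \<Rightarrow> bool" where
  "W12_fun L f \<longleftrightarrow> L2_fun L f \<and> (\<exists>g. is_weak_deriv L f g \<and> L2_fun L g)"

text \<open>
  Endpoint values of a Sobolev function are those of its continuous representative, which is
  unique on the closed interval from \<open>0\<close> to \<open>L\<close> when \<open>L > 0\<close>.
\<close>

definition cont_rep :: "real \<Rightarrow> (real \<Rightarrow> real) \<Rightarrow> real \<Rightarrow> real" where
  "cont_rep L f =
     (SOME g. continuous_on {0..L} g \<and> (AE x in edge_measure L. g x = f x))"

text \<open>
  \<open>f\<close> is integrable and its distributional derivative has finite total variation.
\<close>

definition BV_fun :: "real \<Rightarrow> (real \<Rightarrow> real) \<Rightarrow> bool" where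
  "BV_fun L f \<longleftrightarrow> integrable (edge_measure L) f \<and>
     (\<exists>C. \<forall>\<phi>. test_fun L \<phi> \<and> (\<forall>x. \<bar>\<phi> x\<bar> \<le> 1) \<longrightarrow>
        integral\<^sup>L (edge_measure L) (\<lambda>x. f x * deriv \<phi> x) \<le> C)"

section \<open>Total variation, perimeter and the two constants\<close>

definition graph_W12 :: "('v, 'e) pre_digraph \<Rightarrow> ('e \<Rightarrow> real) \<Rightarrow> ('e \<Rightarrow> real \<Rightarrow> real) set" where
  "graph_W12 G len = {z. \<forall>e\<in>arcs G. W12_fun (len e) (z e)}"

definition graph_BV :: "('v, 'e) pre_digraph \<Rightarrow> ('e \<Rightarrow> real) \<Rightarrow> ('e \<Rightarrow> real \<Rightarrow> real) set" where
  "graph_BV G len = {u. \<forall>e\<in>arcs G. BV_fun (len e) (u e)}"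

definition graph_deriv :: "('e \<Rightarrow> real) \<Rightarrow> ('e \<Rightarrow> real \<Rightarrow> real) \<Rightarrow> 'e \<Rightarrow> real \<Rightarrow> real" where
  "graph_deriv len z e = weak_deriv (len e) (z e)"

definition Linf_norm ::
    "('v, 'e) pre_digraph \<Rightarrow> ('e \<Rightarrow> real) \<Rightarrow> ('e \<Rightarrow> real \<Rightarrow> real) \<Rightarrow> ereal" where
  "Linf_norm G len z = (SUP e\<in>arcs G. esssup (edge_measure (len e)) (\<lambda>x. ereal \<bar>z e x\<bar>))"

text \<open>The outward signed value of \<open>z\<close> on the edge \<open>e\<close> at its endpoint \<open>v\<close>.\<close>

definition vertex_value ::
    "('v, 'e) pre_digraph \<Rightarrow> ('e \<Rightarrow> real) \<Rightarrow> ('e \<Rightarrow> real \<Rightarrow> real) \<Rightarrow> 'e \<Rightarrow> 'v \<Rightarrow> real" where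
  "vertex_value G len z e v =
     (if v = head G e then cont_rep (len e) (z e) (len e)
      else if v = tail G e then - cont_rep (len e) (z e) 0
      else 0)"

definition X_K :: "('v, 'e) pre_digraph \<Rightarrow> ('e \<Rightarrow> real) \<Rightarrow> ('e \<Rightarrow> real \<Rightarrow> real) set" where
  "X_K G len = {z \<in> graph_W12 G len.
     \<forall>v\<in>verts G. (\<Sum>e\<in>incident_edges G v. vertex_value G len z e v) = 0}"

text \<open>
  Pitfall: for a merely integrable unbounded \<open>u\<close> the product with the square integrable derivative
  of \<open>z\<close> need not be integrable, and the Bochner integral is then \<open>0\<close>, so that such \<open>z\<close> do not
  contribute. For functions of bounded variation and characteristic functions, which are bounded,
  the product is always integrable.
\<close>

definition TV :: "('v, 'e) pre_digraph \<Rightarrow> ('e \<Rightarrow> real) \<Rightarrow> ('e \<Rightarrow> real \<Rightarrow> real) \<Rightarrow> ennreal" where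
  "TV G len u =
     (SUP z\<in>{z \<in> X_K G len. Linf_norm G len z \<le> 1}.
        ennreal \<bar>graph_integral G len (\<lambda>e x. u e x * graph_deriv len z e x)\<bar>)"

definition Per :: "('v, 'e) pre_digraph \<Rightarrow> ('e \<Rightarrow> real) \<Rightarrow> ('e \<times> real) set \<Rightarrow> ennreal" where
  "Per G len E = TV G len (char_fun E)"

text \<open>
  Both infima are taken in \<open>[0, \<infinity>]\<close>; they are \<open>\<infinity>\<close> if \<open>\<Omega>\<close> has no subset of positive length
  and finite perimeter.
\<close>

definition cheeger_const ::
    "('v, 'e) pre_digraph \<Rightarrow> ('e \<Rightarrow> real) \<Rightarrow> ('e \<times> real) set \<Rightarrow> ennreal" where
  "cheeger_const G len \<Omega> =
     (INF E\<in>{E. graph_measurable G len E \<and> E \<subseteq> \<Omega> \<and> 0 < graph_length G len E}.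
        Per G len E / ennreal (graph_length G len E))"

definition Lambda_const ::
    "('v, 'e) pre_digraph \<Rightarrow> ('e \<Rightarrow> real) \<Rightarrow> ('e \<times> real) set \<Rightarrow> ennreal" where
  "Lambda_const G len \<Omega> =
     (INF u\<in>{u \<in> graph_BV G len.
          graph_AE G len (\<lambda>e x. (e, x) \<notin> \<Omega> \<longrightarrow> u e x = 0) \<and>
          graph_AE G len (\<lambda>e x. 0 \<le> u e x) \<and>
          \<not> graph_AE G len (\<lambda>e x. u e x = 0) \<and>
          0 < TV G len u}.
        TV G len u / ennreal (graph_integral G len u))"

end

theory Submission
  imports Defs
begin

text \<open>
  Characteristic functions are admissible for \<open>Lambda_const\<close> as soon as their perimeter is finite
  and positive; positivity comes from connectedness, which allows to solve \<open>z' = char_fun E - m\<close>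
  (\<open>m\<close> the mean of \<open>char_fun E\<close>) with a field \<open>z\<close> satisfying Kirchhoff's law.

  For the other inequality one needs \<open>\<integral> Per {u > t} dt \<le> TV u\<close>. Replace \<open>u\<close> by its averages \<open>u\<^sub>N\<close>
  over \<open>N\<close> equal cells of each edge. There is one piecewise linear field \<open>z\<^sub>N\<close> that is optimal for
  all superlevel sets of \<open>u\<^sub>N\<close> simultaneously: at an interior node it is the sign of the jump of
  \<open>u\<^sub>N\<close>, and at a vertex its outward values are \<open>1\<close> on the edges where \<open>u\<^sub>N\<close> exceeds a median and
  \<open>-1\<close> where it is below. Since \<open>z\<^sub>N'\<close> is constant on cells,
  \<open>TV u \<ge> \<integral> u z\<^sub>N' = \<integral> u\<^sub>N z\<^sub>N'\<close>, which is the integral over \<open>t\<close> of the perimeters of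
  \<open>{u\<^sub>N > t}\<close> relative to the discretization. These dominate \<open>\<integral>\<^bsub>{u\<^sub>N > t}\<^esub> z'\<close> for every
  admissible \<open>z\<close>, and \<open>u\<^sub>N \<rightarrow> u\<close> almost everywhere along a subsequence, so Fatou's lemma
  concludes.
\<close>

section \<open>Step functions on equal cells of an edge\<close>

text \<open>The obstacle is an exchange of supremum and integral. Formally, \<integral> u z' is the
  integral over t > 0 of the integrals of z' over {u > t}, but a field that nearly attains the
  perimeter at one level may be poor at another; the integral of the perimeters is controlled by
  \<open>TV u\<close> only if one field serves all levels. For a step function the optimization
  splits into independent problems at the nodes. An interior jump of a superlevel set costs 1. At a
  vertex of degree d, balanced weights of modulus at most 1 sum over k chosen edges to at most min k
  (d - k); as t decreases, the smaller of the two numbers changes from k to d - k at a median of the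
  incident values. This is why weights fixed by a median are right on both sides of it. Averages of
  \<open>u\<close> are taken because averaging is dual to testing with slopes constant on cells: the
  discrete field tests \<open>u\<close> itself, without error term. The limit then needs only lower
  semicontinuity of the perimeter, for t outside the countable set of levels at which {u = t} has
  positive length.\<close>

lemma edge_integral_interval:
  fixes f :: "real \<Rightarrow> real"
  assumes f: "integrable (edge_measure L) f" and "0 \<le> a" "b \<le> L"
  shows "f absolutely_integrable_on {a..b}"
    and "integral {a..b} f = (\<integral>x. f x * indicator {a<..<b} x \<partial>edge_measure L)"
    and "integrable (edge_measure L) (\<lambda>x. f x * indicator {a<..<b} x)"
proof -
  have "integrable lebesgue (\<lambda>x. indicator {0<..<L} x *\<^sub>R f x)"
    using f by (simp add: integrable_restrict_space)
  then have "set_integrable lebesgue {0<..<L} f"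
    by (simp add: set_integrable_def)
  then have *: "set_integrable lebesgue {a<..<b} f"
    by (rule set_integrable_subset) (use assms in auto)
  then show "f absolutely_integrable_on {a..b}"
    using absolutely_integrable_on_open_interval[where f=f and a=a and b=b] by simp
  have "integral {a..b} f = integral {a<..<b} f"
    by (simp add: integral_open_interval_real)
  also have "\<dots> = set_lebesgue_integral lebesgue {a<..<b} f"
    using set_lebesgue_integral_eq_integral(2)[OF *] by simp
  also have "\<dots> = (\<integral>x. f x * indicator {a<..<b} x \<partial>edge_measure L)"
    unfolding set_lebesgue_integral_def
    by (subst integral_restrict_space) (use assms in \<open>auto intro!: Bochner_Integration.integral_cong simp: indicator_def\<close>)
  finally show "integral {a..b} f = (\<integral>x. f x * indicator {a<..<b} x \<partial>edge_measure L)" .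
  have "(\<lambda>x. indicator {0<..<L} x *\<^sub>R (f x * indicator {a<..<b} x)) = (\<lambda>x. indicator {a<..<b} x *\<^sub>R f x)"
    using assms by (auto simp: indicator_def)
  then show "integrable (edge_measure L) (\<lambda>x. f x * indicator {a<..<b} x)"
    using * by (simp add: integrable_restrict_space set_integrable_def)
qed

lemma finite_measure_edge [simp, intro]: "finite_measure (edge_measure L)"
  by (intro finite_measure_lebesgue_on) simp

lemma integrable_edge_bounded:
  fixes f :: "real \<Rightarrow> real"
  assumes "f \<in> borel_measurable (edge_measure L)" "AE x in edge_measure L. \<bar>f x\<bar> \<le> B"
  shows "integrable (edge_measure L) f"
  using assms by (intro finite_measure.integrable_const_bound[where B=B]) auto

lemma integrable_edge_mult_bounded:
  fixes f g :: "real \<Rightarrow> real"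
  assumes "integrable (edge_measure L) f" "g \<in> borel_measurable (edge_measure L)"
    and "AE x in edge_measure L. \<bar>g x\<bar> \<le> B"
  shows "integrable (edge_measure L) (\<lambda>x. f x * g x)"
proof (rule Bochner_Integration.integrable_bound[where f="\<lambda>x. B * f x"])
  show "AE x in edge_measure L. norm (f x * g x) \<le> norm (B * f x)"
    using assms(3)
  proof eventually_elim
    case (elim x)
    then have "\<bar>f x\<bar> * \<bar>g x\<bar> \<le> \<bar>f x\<bar> * \<bar>B\<bar>" by (intro mult_left_mono) auto
    then show ?case by (simp add: abs_mult mult.commute)
  qed
qed (use assms in auto)

lemma borel_measurable_edge: "f \<in> borel_measurable borel \<Longrightarrow> f \<in> borel_measurable (edge_measure L)"
  by (simp add: measurable_completion measurable_restrict_space1)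

lemma AE_edge_neq: "AE x in edge_measure L. x \<noteq> c"
proof (rule AE_I')
  show "{c} \<inter> {0<..<L} \<in> null_sets (edge_measure L)"
    by (subst null_sets_restrict_space) (auto simp: null_sets_completionI finite_imp_null_set_lborel)
qed (auto simp: space_restrict_space)

text \<open>Open cells are pairwise disjoint. The nodes they omit are a null set, on which step
  functions take the value 0, so identities for step functions are stated cellwise or almost
  everywhere.\<close>

definition cell :: "real \<Rightarrow> nat \<Rightarrow> nat \<Rightarrow> real set" where
  "cell L N j = {real j * L / real N<..<real (Suc j) * L / real N}"

definition step_fun :: "real \<Rightarrow> nat \<Rightarrow> (nat \<Rightarrow> real) \<Rightarrow> real \<Rightarrow> real" where
  "step_fun L N a x = (\<Sum>j<N. a j * indicator (cell L N j) x)"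

definition cell_integral :: "real \<Rightarrow> nat \<Rightarrow> (real \<Rightarrow> real) \<Rightarrow> nat \<Rightarrow> real" where
  "cell_integral L N f j = (\<integral>x. f x * indicator (cell L N j) x \<partial>edge_measure L)"

definition cell_average :: "real \<Rightarrow> nat \<Rightarrow> (real \<Rightarrow> real) \<Rightarrow> nat \<Rightarrow> real" where
  "cell_average L N f j = real N / L * cell_integral L N f j"

lemma cell_bounds: "0 < L \<Longrightarrow> j < N \<Longrightarrow> 0 \<le> real j * L / real N"
  "0 < L \<Longrightarrow> j < N \<Longrightarrow> real (Suc j) * L / real N \<le> L"
  "0 < L \<Longrightarrow> j < N \<Longrightarrow> real j * L / real N < real (Suc j) * L / real N"
  by (auto simp: divide_simps mult_left_mono mult_right_mono)

lemma cell_disjoint: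
  assumes "0 < L" "x \<in> cell L N i" "x \<in> cell L N j"
  shows "i = j"
proof (rule ccontr)
  have *: False if "i < j" "x \<in> cell L N i" "x \<in> cell L N j" for i j
  proof -
    have "real (Suc i) * L / real N \<le> real j * L / real N"
      using that(1) assms(1) by (intro divide_right_mono mult_right_mono) auto
    then show False using that by (auto simp: cell_def)
  qed
  assume "i \<noteq> j" then show False using * assms by (metis nat_neq_iff)
qed

lemma step_fun_cell:
  assumes "0 < L" "j < N" "x \<in> cell L N j"
  shows "step_fun L N a x = a j"
proof -
  have *: "x \<in> cell L N i \<longleftrightarrow> i = j" for i
    using cell_disjoint[OF assms(1) _ assms(3)] assms(3) by blast
  have "step_fun L N a x = (\<Sum>i<N. if i = j then a j else 0)"
    unfolding step_fun_def by (intro sum.cong) (auto simp: indicator_def *)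
  then show ?thesis using assms by simp
qed

lemma AE_cell:
  assumes "0 < L" "0 < N"
  shows "AE x in edge_measure L. \<exists>j<N. x \<in> cell L N j"
proof -
  \<comment> \<open>Index \<open>N\<close> is included because it gives the right end of the last
    cell.\<close>
  have "AE x in edge_measure L. \<forall>j\<in>{..N}. x \<noteq> real j * L / real N"
    by (rule AE_finite_allI) (auto intro: AE_edge_neq)
  moreover have "AE x in edge_measure L. x \<in> {0<..<L}"
    using AE_space[of "edge_measure L"] by (simp add: space_restrict_space)
  ultimately show ?thesis
  proof eventually_elim
    case (elim x)
    define j where "j = nat \<lfloor>x * N / L\<rfloor>"
    have x0: "0 \<le> x * N / L" and xN: "x * N / L < N" using elim assms by (auto simp: divide_simps)
    then have jN: "j < N" unfolding j_def by linarith
    have j: "real j \<le> x * N / L" "x * N / L < real j + 1" unfolding j_def using x0 by linarith+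
    have "x \<noteq> real j * L / real N" "x \<noteq> real (Suc j) * L / real N" using elim(1) jN by (metis atMost_iff less_imp_le Suc_leI)+
    moreover have "real j * L / real N \<le> x" using j assms by (simp add: field_simps)
    moreover have "x \<le> real (Suc j) * L / real N" using j assms by (simp add: field_simps)
    ultimately show ?case using jN by (intro exI[of _ j]) (auto simp: cell_def)
  qed
qed

lemma step_fun_measurable: "step_fun L N a \<in> borel_measurable borel"
  unfolding step_fun_def cell_def by measurable

lemma step_fun_bounded: "\<bar>step_fun L N a x\<bar> \<le> (\<Sum>j<N. \<bar>a j\<bar>)"
  unfolding step_fun_def by (rule order_trans[OF sum_abs]) (auto intro!: sum_mono simp: indicator_def)

lemma integrable_cell:
  fixes f :: "real \<Rightarrow> real"
  assumes "0 < L" "j < N" "integrable (edge_measure L) f"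
  shows "integrable (edge_measure L) (\<lambda>x. f x * indicator (cell L N j) x)"
  unfolding cell_def by (rule edge_integral_interval(3)[OF assms(3) cell_bounds(1,2)[OF assms(1,2)]])

lemma integrable_mult_step:
  assumes "integrable (edge_measure L) f"
  shows "integrable (edge_measure L) (\<lambda>x. f x * step_fun L N a x)"
  by (rule integrable_edge_mult_bounded[OF assms])
     (auto intro!: borel_measurable_edge step_fun_measurable step_fun_bounded AE_I2)

text \<open>A step function sees \<open>f\<close> only through its cell integrals. This is what
  makes testing \<open>u\<close> and testing its cell averages the same thing.\<close>

lemma integral_mult_step:
  assumes "0 < L" "integrable (edge_measure L) f"
  shows "(\<integral>x. f x * step_fun L N a x \<partial>edge_measure L) = (\<Sum>j<N. a j * cell_integral L N f j)"
proof -
  have "(\<integral>x. f x * step_fun L N a x \<partial>edge_measure L)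
      = (\<integral>x. (\<Sum>j<N. a j * (f x * indicator (cell L N j) x)) \<partial>edge_measure L)"
    unfolding step_fun_def sum_distrib_left by (simp only: mult_ac)
  also have "\<dots> = (\<Sum>j<N. a j * cell_integral L N f j)"
    unfolding cell_integral_def using assms
    by (subst Bochner_Integration.integral_sum) (auto intro!: integrable_cell)
  finally show ?thesis .
qed

lemma cell_integral_eq:
  assumes "0 < L" "j < N" "integrable (edge_measure L) f"
  shows "cell_integral L N f j = integral {real j * L / real N..real (Suc j) * L / real N} f"
  unfolding cell_integral_def cell_def using assms cell_bounds[of L j N]
  by (subst edge_integral_interval(2)[where L=L]) auto

lemma integrable_edge_const [simp]: "integrable (edge_measure L) (\<lambda>x. c :: real)"
  by (rule integrable_edge_bounded[where B="\<bar>c\<bar>"]) auto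

lemma cell_integral_const:
  assumes "0 < L" "j < N"
  shows "cell_integral L N (\<lambda>x. c) j = c * L / real N"
  using assms cell_bounds(3)[OF assms] by (subst cell_integral_eq) (auto simp: field_simps)

lemma integral_cells:
  assumes "0 < L" "0 < N" "integrable (edge_measure L) f"
  shows "(\<integral>x. f x \<partial>edge_measure L) = (\<Sum>j<N. cell_integral L N f j)"
proof -
  have "(\<integral>x. f x \<partial>edge_measure L) = (\<integral>x. f x * step_fun L N (\<lambda>_. 1) x \<partial>edge_measure L)"
  proof (rule integral_cong_AE)
    show "AE x in edge_measure L. f x = f x * step_fun L N (\<lambda>_. 1) x"
      using AE_cell[OF assms(1,2)] by eventually_elim (auto simp: step_fun_cell[OF assms(1)])
  qed (use assms integrable_mult_step in blast)+
  then show ?thesis by (simp add: integral_mult_step assms)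
qed

lemma abs_step_fun:
  assumes "0 < L" "0 < N"
  shows "AE x in edge_measure L. \<bar>step_fun L N a x\<bar> = step_fun L N (\<lambda>j. \<bar>a j\<bar>) x"
  using AE_cell[OF assms] by eventually_elim (auto simp: step_fun_cell[OF assms(1)])

lemma integrable_step [simp]: "integrable (edge_measure L) (step_fun L N a)"
  using integrable_mult_step[of L "\<lambda>_. 1"] by simp

text \<open>The triangle inequality for integrals on each cell. The bound is uniform in
  \<open>N\<close>, which lets convergence of averages pass from continuous to integrable functions
  by density.\<close>

lemma cell_average_contraction:
  assumes "0 < L" "0 < N" "integrable (edge_measure L) f"
  shows "(\<integral>x. \<bar>step_fun L N (cell_average L N f) x\<bar> \<partial>edge_measure L) \<le> (\<integral>x. \<bar>f x\<bar> \<partial>edge_measure L)"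
proof -
  have "(\<integral>x. \<bar>step_fun L N (cell_average L N f) x\<bar> \<partial>edge_measure L)
      = (\<integral>x. 1 * step_fun L N (\<lambda>j. \<bar>cell_average L N f j\<bar>) x \<partial>edge_measure L)"
    using abs_step_fun[OF assms(1,2)] by (intro integral_cong_AE) (auto intro!: borel_measurable_edge borel_measurable_abs step_fun_measurable)
  also have "\<dots> = (\<Sum>j<N. \<bar>cell_average L N f j\<bar> * cell_integral L N (\<lambda>x. 1) j)"
    using assms by (intro integral_mult_step) auto
  also have "\<dots> = (\<Sum>j<N. \<bar>cell_integral L N f j\<bar>)"
    using assms by (intro sum.cong) (auto simp: cell_integral_const cell_average_def abs_mult)
  also have "\<dots> \<le> (\<Sum>j<N. cell_integral L N (\<lambda>x. \<bar>f x\<bar>) j)"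
  proof (rule sum_mono)
    fix j assume "j \<in> {..<N}"
    show "\<bar>cell_integral L N f j\<bar> \<le> cell_integral L N (\<lambda>x. \<bar>f x\<bar>) j"
      unfolding cell_integral_def
      by (rule order_trans[OF integral_abs_bound]) (simp add: abs_mult)
  qed
  also have "\<dots> = (\<integral>x. \<bar>f x\<bar> \<partial>edge_measure L)"
    using assms by (simp add: integral_cells)
  finally show ?thesis .
qed

section \<open>Convergence of cell averages\<close>

text \<open>Measurability yields continuous functions converging to \<open>f\<close> almost
  everywhere, but with no integrable majorant. Truncating \<open>f\<close> at a large height costs
  little in L1; truncating the approximants at the same height \<open>m\<close> keeps them
  continuous and makes 2m a majorant.\<close>

lemma edge_L1_dense:
  fixes f :: "real \<Rightarrow> real"
  assumes f: "integrable (edge_measure L) f" and "0 < \<epsilon>"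
  obtains g where "continuous_on UNIV g" "(\<integral>x. \<bar>f x - g x\<bar> \<partial>edge_measure L) < \<epsilon>"
proof -
  define clamp :: "nat \<Rightarrow> real \<Rightarrow> real" where "clamp m y = max (- real m) (min (real m) y)" for m y
  have cont: "continuous_on UNIV (clamp m)" for m unfolding clamp_def by (intro continuous_intros)
  then have [measurable]: "clamp m \<in> borel_measurable borel" for m
    by (rule borel_measurable_continuous_onI)
  have [measurable]: "f \<in> borel_measurable (edge_measure L)" using f by simp
  have bd: "\<bar>clamp m y\<bar> \<le> m" for m y by (auto simp: clamp_def)
  have "(\<lambda>m. \<integral>x. \<bar>f x - clamp m (f x)\<bar> \<partial>edge_measure L) \<longlonglongrightarrow> (\<integral>x. 0 \<partial>edge_measure L)"
  proof (rule integral_dominated_convergence[where w="\<lambda>x. \<bar>f x\<bar>"])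
    have "\<forall>\<^sub>F m in sequentially. \<bar>y - clamp m y\<bar> = 0" for y
      using eventually_ge_at_top[of "nat \<lceil>\<bar>y\<bar>\<rceil>"] by eventually_elim (auto simp: clamp_def nat_le_iff ceiling_le_iff)
    then show "AE x in edge_measure L. (\<lambda>m. \<bar>f x - clamp m (f x)\<bar>) \<longlonglongrightarrow> 0"
      by (intro AE_I2 tendsto_eventually)
    show "AE x in edge_measure L. norm \<bar>f x - clamp m (f x)\<bar> \<le> \<bar>f x\<bar>" for m
      by (auto simp: clamp_def)
  qed (use f in auto)
  then have "\<forall>\<^sub>F m in sequentially. (\<integral>x. \<bar>f x - clamp m (f x)\<bar> \<partial>edge_measure L) < \<epsilon>/2"
    using \<open>0 < \<epsilon>\<close> by (intro order_tendstoD) auto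
  then obtain m where m: "(\<integral>x. \<bar>f x - clamp m (f x)\<bar> \<partial>edge_measure L) < \<epsilon>/2"
    by (auto simp: eventually_sequentially)
  define f0 where "f0 x = (if x \<in> {0<..<L} then f x else 0)" for x
  have "f0 \<in> borel_measurable lebesgue"
    unfolding f0_def using borel_measurable_if_I[OF borel_measurable_integrable[OF f]] by simp
  then have "f0 measurable_on {0<..<L}" by (intro lebesgue_measurable_imp_measurable_on_real) auto
  then obtain N g where N: "negligible N" and g: "\<And>n. continuous_on UNIV (g n)"
    and lim: "\<And>x. x \<notin> N \<Longrightarrow> (\<lambda>n. g n x) \<longlonglongrightarrow> (if x \<in> {0<..<L} then f0 x else 0)"
    unfolding measurable_on_def by blast
  have [measurable]: "g n \<in> borel_measurable (edge_measure L)" for n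
    using g by (intro borel_measurable_edge borel_measurable_continuous_onI)
  have AEN: "AE x in edge_measure L. x \<notin> N"
    using N by (auto simp: AE_restrict_space_iff negligible_iff_null_sets intro: AE_not_in eventually_mono)
  have AEL: "AE x in edge_measure L. x \<in> {0<..<L}"
    using AE_space[of "edge_measure L"] by (simp add: space_restrict_space)
  have "(\<lambda>n. \<integral>x. \<bar>clamp m (f x) - clamp m (g n x)\<bar> \<partial>edge_measure L) \<longlonglongrightarrow> (\<integral>x. 0 \<partial>edge_measure L)"
  proof (rule integral_dominated_convergence[where w="\<lambda>x. 2 * real m"])
    show "AE x in edge_measure L. (\<lambda>n. \<bar>clamp m (f x) - clamp m (g n x)\<bar>) \<longlonglongrightarrow> 0"
      using AEN AEL
    proof eventually_elim
      case (elim x)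
      then have "(\<lambda>n. g n x) \<longlonglongrightarrow> f x" using lim[of x] by (simp add: f0_def)
      then have "(\<lambda>n. clamp m (g n x)) \<longlonglongrightarrow> clamp m (f x)"
        unfolding clamp_def by (intro tendsto_intros)
      then have "(\<lambda>n. \<bar>clamp m (f x) - clamp m (g n x)\<bar>) \<longlonglongrightarrow> \<bar>clamp m (f x) - clamp m (f x)\<bar>"
        by (intro tendsto_intros)
      then show ?case by simp
    qed
    show "AE x in edge_measure L. norm \<bar>clamp m (f x) - clamp m (g n x)\<bar> \<le> 2 * real m" for n
      using bd[of m] by (intro AE_I2) (smt (verit) real_norm_def)
  qed auto
  then have "\<forall>\<^sub>F n in sequentially. (\<integral>x. \<bar>clamp m (f x) - clamp m (g n x)\<bar> \<partial>edge_measure L) < \<epsilon>/2"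
    using \<open>0 < \<epsilon>\<close> by (intro order_tendstoD) auto
  then obtain n where n: "(\<integral>x. \<bar>clamp m (f x) - clamp m (g n x)\<bar> \<partial>edge_measure L) < \<epsilon>/2"
    by (auto simp: eventually_sequentially)
  have i: "integrable (edge_measure L) (\<lambda>x. clamp m (h x))" if "h \<in> borel_measurable (edge_measure L)" for h
    using that bd by (intro integrable_edge_bounded[where B=m]) auto
  have "(\<integral>x. \<bar>f x - clamp m (g n x)\<bar> \<partial>edge_measure L)
      \<le> (\<integral>x. \<bar>f x - clamp m (f x)\<bar> + \<bar>clamp m (f x) - clamp m (g n x)\<bar> \<partial>edge_measure L)"
    using f i by (intro integral_mono) auto
  also have "\<dots> < \<epsilon>"
    using m n f i by (subst Bochner_Integration.integral_add) auto
  finally show thesis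
    using continuous_on_compose[OF g[of n] continuous_on_subset[OF cont[of m]]]
    by (intro that[of "\<lambda>x. clamp m (g n x)"]) (auto simp: o_def)
qed

lemma integrable_edge_continuous:
  fixes g :: "real \<Rightarrow> real"
  assumes "continuous_on {0..L} g"
  shows "integrable (edge_measure L) g"
  by (rule absolutely_integrable_imp_integrable[OF set_integrable_subset[OF absolutely_integrable_continuous_real[OF assms]]]) auto

lemma step_fun_diff: "step_fun L N (\<lambda>j. a j - b j) x = step_fun L N a x - step_fun L N b x"
  by (simp add: step_fun_def sum_subtractf left_diff_distrib)

lemma cell_average_diff:
  assumes "0 < L" "j < N" "integrable (edge_measure L) f" "integrable (edge_measure L) g"
  shows "cell_average L N (\<lambda>x. f x - g x) j = cell_average L N f j - cell_average L N g j"
  using integrable_cell[OF assms(1,2,3)] integrable_cell[OF assms(1,2,4)]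
  by (simp add: cell_average_def cell_integral_def left_diff_distrib right_diff_distrib)

lemma step_fun_cong: "(\<And>j. j < N \<Longrightarrow> a j = b j) \<Longrightarrow> step_fun L N a = step_fun L N b"
  by (auto simp: step_fun_def fun_eq_iff)

lemma cell_average_continuous:
  assumes L: "0 < L" and g: "continuous_on {0..L} g" and "0 < \<epsilon>"
  shows "\<forall>\<^sub>F N in sequentially. AE x in edge_measure L. \<bar>step_fun L N (cell_average L N g) x - g x\<bar> \<le> \<epsilon>"
proof -
  have "uniformly_continuous_on {0..L} g"
    using g by (simp add: compact_uniformly_continuous)
  then obtain \<delta> where \<delta>: "0 < \<delta>"
    "\<And>x y. x \<in> {0..L} \<Longrightarrow> y \<in> {0..L} \<Longrightarrow> \<bar>x - y\<bar> < \<delta> \<Longrightarrow> \<bar>g x - g y\<bar> < \<epsilon>"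
    using \<open>0 < \<epsilon>\<close> unfolding uniformly_continuous_on_def dist_real_def by (metis abs_minus_commute)
  have "\<forall>\<^sub>F N in sequentially. nat \<lceil>L/\<delta>\<rceil> < N" by (rule eventually_gt_at_top)
  then show ?thesis
  proof eventually_elim
    case (elim N)
    then have N: "0 < N" "L / real N < \<delta>" using \<delta>(1) L
      by (auto simp: field_simps) (smt (verit) divide_less_eq mult.commute nat_less_iff of_int_less_iff of_nat_less_iff real_nat_ceiling_ge)
    show ?case using AE_cell[OF L N(1)]
    proof eventually_elim
      case (elim x)
      then obtain j where j: "j < N" "x \<in> cell L N j" by blast
      let ?a = "real j * L / real N" and ?b = "real (Suc j) * L / real N"
      have ab: "0 \<le> ?a" "?b \<le> L" "?a < ?b" using cell_bounds[OF L j(1)] by auto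
      have len: "?b - ?a = L / real N" using N by (simp add: field_simps)
      have xin: "?a < x" "x < ?b" using j(2) by (auto simp: cell_def)
      have gi: "g integrable_on {?a..?b}"
        using ab by (intro integrable_continuous_real continuous_on_subset[OF g]) auto
      have near: "\<bar>g y - g x\<bar> \<le> \<epsilon>" if "y \<in> {?a..?b}" for y
      proof -
        have "\<bar>y - x\<bar> \<le> ?b - ?a" using that xin unfolding atLeastAtMost_iff abs_le_iff by linarith
        then have "\<bar>g y - g x\<bar> < \<epsilon>"
          using that ab xin N unfolding len atLeastAtMost_iff by (intro \<delta>(2)) (unfold atLeastAtMost_iff, linarith+)
        then show ?thesis by simp
      qed
      have "integral {?a..?b} (\<lambda>y. g y - g x) = integral {?a..?b} g - g x * (?b - ?a)"
        using gi ab by (subst Henstock_Kurzweil_Integration.integral_diff) auto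
      moreover have "norm (integral {?a..?b} (\<lambda>y. g y - g x)) \<le> \<epsilon> * (?b - ?a)"
        using near ab by (intro integral_bound continuous_intros continuous_on_subset[OF g]) auto
      ultimately have "\<bar>integral {?a..?b} g - g x * (L / real N)\<bar> \<le> \<epsilon> * (L / real N)"
        unfolding len by simp
      then have "real N / L * \<bar>integral {?a..?b} g - g x * (L / real N)\<bar> \<le> real N / L * (\<epsilon> * (L / real N))"
        using L by (intro mult_left_mono) auto
      moreover have "real N / L * \<bar>integral {?a..?b} g - g x * (L / real N)\<bar> = \<bar>real N / L * integral {?a..?b} g - g x\<bar>"
      proof -
        have "real N / L * (y - g x * (L / real N)) = real N / L * y - g x" for y
          using L N by (simp add: field_simps)
        moreover have "real N / L * \<bar>y\<bar> = \<bar>real N / L * y\<bar>" for y using L by (simp add: abs_mult)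
        ultimately show ?thesis by (simp only:)
      qed
      moreover have "cell_average L N g j = real N / L * integral {?a..?b} g"
      proof -
        show ?thesis using L j integrable_edge_continuous[OF g] by (simp add: cell_average_def cell_integral_eq)
      qed
      ultimately show ?case using L N j by (simp add: step_fun_cell)
    qed
  qed
qed

lemma cell_average_tendsto_L1:
  assumes L: "0 < L" and f: "integrable (edge_measure L) f"
  shows "(\<lambda>N. \<integral>x. \<bar>step_fun L N (cell_average L N f) x - f x\<bar> \<partial>edge_measure L) \<longlonglongrightarrow> 0"
proof (rule LIMSEQ_I)
  fix \<epsilon> :: real assume "0 < \<epsilon>"
  then obtain g where g: "continuous_on UNIV g" and fg: "(\<integral>x. \<bar>f x - g x\<bar> \<partial>edge_measure L) < \<epsilon>/4"
    using edge_L1_dense[OF f, of "\<epsilon>/4"] by auto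
  have gi: "integrable (edge_measure L) g"
    by (intro integrable_edge_continuous continuous_on_subset[OF g]) simp
  \<comment> \<open>The uniform error \<epsilon>/(4*L) integrates to \<epsilon>/4 over an edge of
    length \<open>L\<close>.\<close>
  have "\<forall>\<^sub>F N in sequentially. AE x in edge_measure L. \<bar>step_fun L N (cell_average L N g) x - g x\<bar> \<le> \<epsilon>/(4*L)"
    using L \<open>0 < \<epsilon>\<close> by (intro cell_average_continuous continuous_on_subset[OF g]) auto
  then have "\<forall>\<^sub>F N in sequentially. \<bar>\<integral>x. \<bar>step_fun L N (cell_average L N f) x - f x\<bar> \<partial>edge_measure L\<bar> < \<epsilon>"
    using eventually_gt_at_top[of 0]
  proof eventually_elim
    case (elim N)
    let ?P = "\<lambda>f. step_fun L N (cell_average L N f)"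
    have P: "?P (\<lambda>x. f x - g x) x = ?P f x - ?P g x" for x
      unfolding step_fun_diff[symmetric]
      by (rule fun_cong[OF step_fun_cong]) (rule cell_average_diff[OF L _ f gi])
    have 1: "(\<integral>x. \<bar>?P (\<lambda>x. f x - g x) x\<bar> \<partial>edge_measure L) \<le> (\<integral>x. \<bar>f x - g x\<bar> \<partial>edge_measure L)"
      using L elim f gi by (intro cell_average_contraction) auto
    have "(\<integral>x. \<bar>?P g x - g x\<bar> \<partial>edge_measure L) \<le> (\<integral>x. \<epsilon>/(4*L) \<partial>edge_measure L)"
      using elim gi by (intro integral_mono_AE) auto
    also have "\<dots> = \<epsilon>/4" using L by (simp add: measure_restrict_space space_restrict_space)
    finally have 2: "(\<integral>x. \<bar>?P g x - g x\<bar> \<partial>edge_measure L) \<le> \<epsilon>/4" .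
    have "(\<integral>x. \<bar>?P f x - f x\<bar> \<partial>edge_measure L)
        \<le> (\<integral>x. (\<bar>?P (\<lambda>x. f x - g x) x\<bar> + \<bar>?P g x - g x\<bar>) + \<bar>f x - g x\<bar> \<partial>edge_measure L)"
      unfolding P using f gi by (intro integral_mono) auto
    also have "\<dots> = ((\<integral>x. \<bar>?P (\<lambda>x. f x - g x) x\<bar> \<partial>edge_measure L) + (\<integral>x. \<bar>?P g x - g x\<bar> \<partial>edge_measure L))
         + (\<integral>x. \<bar>f x - g x\<bar> \<partial>edge_measure L)"
      using f gi by simp
    also have "\<dots> < \<epsilon>" using 1 2 fg \<open>0 < \<epsilon>\<close> by linarith
    finally show ?case by (simp add: abs_of_nonneg)
  qed
  then show "\<exists>no. \<forall>n\<ge>no. norm ((\<integral>x. \<bar>step_fun L n (cell_average L n f) x - f x\<bar> \<partial>edge_measure L) - 0) < \<epsilon>"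
    by (simp add: eventually_sequentially)
qed

text \<open>All averages equal \<open>c\<close>, and they converge to \<open>f\<close> in L1. The
  lemma is the uniqueness principle for integrable functions with given cell integrals, used below
  both for functions with zero weak derivative and for identifying weak derivatives.\<close>

lemma AE_const_if_cell_integrals_eq:
  assumes L: "0 < L" and f: "integrable (edge_measure L) f"
    and eq: "\<And>N j. 0 < N \<Longrightarrow> j < N \<Longrightarrow> cell_integral L N f j = c * L / real N"
  shows "AE x in edge_measure L. f x = c"
proof -
  have "(\<integral>x. \<bar>step_fun L N (cell_average L N f) x - f x\<bar> \<partial>edge_measure L) = (\<integral>x. \<bar>c - f x\<bar> \<partial>edge_measure L)"
    if "0 < N" for N
  proof (rule integral_cong_AE)
    show "AE x in edge_measure L. \<bar>step_fun L N (cell_average L N f) x - f x\<bar> = \<bar>c - f x\<bar>"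
      using AE_cell[OF L that]
      by eventually_elim (use L that in \<open>auto simp: step_fun_cell cell_average_def eq\<close>)
  qed (use f borel_measurable_integrable[OF integrable_step] in auto)
  then have "(\<lambda>N. \<integral>x. \<bar>step_fun L N (cell_average L N f) x - f x\<bar> \<partial>edge_measure L)
     \<longlonglongrightarrow> (\<integral>x. \<bar>c - f x\<bar> \<partial>edge_measure L)"
    by (intro tendsto_eventually eventually_mono[OF eventually_gt_at_top[of 0]])
  then have "(\<integral>x. \<bar>c - f x\<bar> \<partial>edge_measure L) = 0"
    using cell_average_tendsto_L1[OF L f] LIMSEQ_unique by blast
  then have "AE x in edge_measure L. \<bar>c - f x\<bar> = 0"
    using f by (subst (asm) integral_nonneg_eq_0_iff_AE) auto
  then show ?thesis by eventually_elim auto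
qed

section \<open>Weak derivatives and primitives\<close>

lemma test_funD:
  assumes "test_fun L \<phi>"
  shows "(\<phi> has_real_derivative deriv \<phi> x) (at x)" "continuous_on UNIV (deriv \<phi>)"
    "x \<notin> {0<..<L} \<Longrightarrow> \<phi> x = 0"
proof -
  from assms have C1: "\<phi> C1_differentiable_on UNIV" and sub: "closure {x. \<phi> x \<noteq> 0} \<subseteq> {0<..<L}"
    by (auto simp: test_fun_def)
  obtain D where D: "\<And>x. (\<phi> has_vector_derivative D x) (at x)" "continuous_on UNIV D"
    using C1 unfolding C1_differentiable_on_def by auto
  then have *: "(\<phi> has_real_derivative D x) (at x)" for x
    by (simp add: has_real_derivative_iff_has_vector_derivative)
  then have "deriv \<phi> = D" by (auto intro: DERIV_imp_deriv)
  with D * show "(\<phi> has_real_derivative deriv \<phi> x) (at x)" "continuous_on UNIV (deriv \<phi>)" by auto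
  show "x \<notin> {0<..<L} \<Longrightarrow> \<phi> x = 0"
    using sub closure_subset[of "{x. \<phi> x \<noteq> 0}"] by blast
qed

section \<open>The lemma of du Bois-Reymond\<close>

text \<open>A continuous cutoff of the interval from \<open>a\<close> to \<open>b\<close>: it
  vanishes within 1/n of the ends or outside, and is 1 at distance at least 2/n inside. The margin
  1/n keeps supports away from the ends of the edge even if \<open>a = 0\<close> or
  \<open>b = L\<close>.\<close>

definition trapezoid :: "nat \<Rightarrow> real \<Rightarrow> real \<Rightarrow> real \<Rightarrow> real" where
  "trapezoid n a b x = min 1 (max 0 (real n * min (x - a) (b - x) - 1))"

lemma trapezoid_bounds: "0 \<le> trapezoid n a b x" "trapezoid n a b x \<le> 1"
  by (auto simp: trapezoid_def)

lemma trapezoid_eq_0: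
  assumes "0 < n" "x \<le> a + 1 / real n \<or> b - 1 / real n \<le> x"
  shows "trapezoid n a b x = 0"
proof -
  have "min (x - a) (b - x) \<le> 1 / real n" using assms by auto
  then have "real n * min (x - a) (b - x) \<le> real n * (1 / real n)" by (intro mult_left_mono) auto
  then show ?thesis using assms(1) by (auto simp: trapezoid_def)
qed

lemma trapezoid_tendsto:
  "(\<lambda>n. trapezoid (Suc n) a b x) \<longlonglongrightarrow> indicator {a<..<b} x"
proof (cases "x \<in> {a<..<b}")
  case True
  define d where "d = min (x - a) (b - x)"
  have d: "0 < d" using True by (auto simp: d_def)
  have "\<forall>\<^sub>F n in sequentially. trapezoid (Suc n) a b x = 1"
    using eventually_ge_at_top[of "nat \<lceil>2/d\<rceil>"]
  proof eventually_elim
    case (elim n)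
    then have "2 / d \<le> real (Suc n)" by linarith
    then have "2 \<le> real (Suc n) * d" using d by (simp add: field_simps)
    then show ?case unfolding trapezoid_def d_def[symmetric] by auto
  qed
  then show ?thesis using True by (simp add: tendsto_eventually)
next
  case False
  have "trapezoid (Suc n) a b x = 0" for n
  proof (rule trapezoid_eq_0)
    have "0 \<le> 1 / real (Suc n)" by simp
    then show "x \<le> a + 1 / real (Suc n) \<or> b - 1 / real (Suc n) \<le> x"
      using False unfolding greaterThanLessThan_iff by linarith
  qed simp
  then show ?thesis using False by simp
qed

text \<open>The primitive of a single trapezoid is not compactly supported. For intervals of equal
  length the trapezoids are translates of each other, so the primitive minus its translate vanishes
  on both sides.\<close>

lemma test_fun_trapezoid_diff:
  assumes n: "0 < n" and "0 \<le> a" "b \<le> L" "0 \<le> c" "d \<le> L" and len: "b - a = d - c"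
  obtains \<phi> where "test_fun L \<phi>" "\<And>x. deriv \<phi> x = trapezoid n a b x - trapezoid n c d x"
proof -
  have cont: "continuous_on UNIV (trapezoid n a b)" for a b
    unfolding trapezoid_def by (intro continuous_intros)
  have "\<exists>F. \<forall>x. - \<infinity> < ereal x \<longrightarrow> ereal x < \<infinity> \<longrightarrow> (F has_vector_derivative trapezoid n a b x) (at x)"
    using cont[of a b] by (intro einterval_antiderivative) (auto simp: continuous_on_eq_continuous_at)
  then obtain F where F: "\<And>x. (F has_real_derivative trapezoid n a b x) (at x)"
    by (auto simp: has_real_derivative_iff_has_vector_derivative)
  define \<phi> where "\<phi> x = F x - F (x - (c - a))" for x
  have shift: "trapezoid n a b (x - (c - a)) = trapezoid n c d x" for x
    using len by (simp add: trapezoid_def algebra_simps)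
  have der: "(\<phi> has_real_derivative trapezoid n a b x - trapezoid n c d x) (at x)" for x
    unfolding \<phi>_def shift[symmetric] by (auto intro!: derivative_eq_intros DERIV_chain2[where f=F] F)
  have "\<exists>k. \<forall>x\<in>{..a + 1/real n}. F x = k"
    by (rule has_field_derivative_zero_constant)
       (use F trapezoid_eq_0[OF n] in \<open>auto intro: has_field_derivative_at_within simp: DERIV_def[symmetric]\<close>, metis has_field_derivative_at_within)
  then obtain k where k: "\<And>x. x \<le> a + 1/real n \<Longrightarrow> F x = k" by auto
  have "\<exists>k. \<forall>x\<in>{b - 1/real n..}. F x = k"
    by (rule has_field_derivative_zero_constant)
       (use F trapezoid_eq_0[OF n] in \<open>auto intro: has_field_derivative_at_within\<close>, metis has_field_derivative_at_within)
  then obtain k' where k': "\<And>x. x \<ge> b - 1/real n \<Longrightarrow> F x = k'" by auto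
  have zero: "\<phi> x = 0" if "x \<le> min a c + 1/real n \<or> x \<ge> max b d - 1/real n" for x
    using that
  proof
    assume "x \<le> min a c + 1/real n"
    then show ?thesis using k[of x] k[of "x - (c - a)"] by (simp add: \<phi>_def)
  next
    assume "x \<ge> max b d - 1/real n"
    then show ?thesis using k'[of x] k'[of "x - (c - a)"] len by (simp add: \<phi>_def)
  qed
  have "{x. \<phi> x \<noteq> 0} \<subseteq> {min a c + 1/real n..max b d - 1/real n}"
  proof
    fix x assume "x \<in> {x. \<phi> x \<noteq> 0}"
    then have "\<not> (x \<le> min a c + 1/real n \<or> x \<ge> max b d - 1/real n)" using zero by blast
    then show "x \<in> {min a c + 1/real n..max b d - 1/real n}" unfolding atLeastAtMost_iff by linarith
  qed
  then have "closure {x. \<phi> x \<noteq> 0} \<subseteq> {min a c + 1/real n..max b d - 1/real n}"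
    by (rule closure_minimal) simp
  also have "\<dots> \<subseteq> {0<..<L}"
  proof -
    have "0 < 1 / real n" using n by simp
    then have "0 < min a c + 1/real n" "max b d - 1/real n < L"
      using assms(2-5) by linarith+
    then show ?thesis unfolding subset_iff atLeastAtMost_iff greaterThanLessThan_iff
      by (meson less_le_trans le_less_trans)
  qed
  finally have "test_fun L \<phi>"
    unfolding test_fun_def C1_differentiable_on_def using der
    by (auto intro!: exI[of _ "\<lambda>x. trapezoid n a b x - trapezoid n c d x"] continuous_intros cont
        simp: has_real_derivative_iff_has_vector_derivative)
  then show thesis using der by (intro that) (auto intro: DERIV_imp_deriv)
qed

text \<open>Differences of trapezoids are derivatives of test functions. In the limit they become
  differences of indicators of intervals of equal length, so \<open>h\<close> has the same integral
  over all cells of a subdivision.\<close>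

lemma AE_const_if_weak_deriv_0:
  assumes L: "0 < L" and h: "integrable (edge_measure L) h"
    and zero: "\<And>\<phi>. test_fun L \<phi> \<Longrightarrow> (\<integral>x. h x * deriv \<phi> x \<partial>edge_measure L) = 0"
  shows "\<exists>c. AE x in edge_measure L. h x = c"
proof -
  have eq: "(\<integral>x. h x * indicator {a<..<b} x \<partial>edge_measure L) = (\<integral>x. h x * indicator {c<..<d} x \<partial>edge_measure L)"
    if that: "0 \<le> a" "b \<le> L" "0 \<le> c" "d \<le> L" "b - a = d - c" for a b c d
  proof -
    have m: "trapezoid n a b \<in> borel_measurable (edge_measure L)" for n a b
      unfolding trapezoid_def by (intro borel_measurable_edge) measurable
    have "(\<lambda>n. \<integral>x. h x * (trapezoid (Suc n) a b x - trapezoid (Suc n) c d x) \<partial>edge_measure L)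
       \<longlonglongrightarrow> (\<integral>x. h x * (indicator {a<..<b} x - indicator {c<..<d} x) \<partial>edge_measure L)"
    proof (rule integral_dominated_convergence[where w="\<lambda>x. \<bar>h x\<bar>"])
      show "AE x in edge_measure L. (\<lambda>n. h x * (trapezoid (Suc n) a b x - trapezoid (Suc n) c d x))
          \<longlonglongrightarrow> h x * (indicator {a<..<b} x - indicator {c<..<d} x)"
        by (intro AE_I2 tendsto_intros trapezoid_tendsto)
      show "AE x in edge_measure L. norm (h x * (trapezoid (Suc n) a b x - trapezoid (Suc n) c d x)) \<le> \<bar>h x\<bar>" for n
      proof (rule AE_I2)
        fix x
        have "\<bar>trapezoid (Suc n) a b x - trapezoid (Suc n) c d x\<bar> \<le> 1"
          using trapezoid_bounds[of "Suc n" a b x] trapezoid_bounds[of "Suc n" c d x] by linarith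
        then show "norm (h x * (trapezoid (Suc n) a b x - trapezoid (Suc n) c d x)) \<le> \<bar>h x\<bar>"
          by (simp add: abs_mult mult_left_le)
      qed
      have "(indicator {a<..<b} :: real \<Rightarrow> real) \<in> borel_measurable (edge_measure L)" for a b
        by (intro borel_measurable_edge) auto
      then show "(\<lambda>x. h x * (indicator {a<..<b} x - indicator {c<..<d} x)) \<in> borel_measurable (edge_measure L)"
        using h by (intro borel_measurable_times borel_measurable_diff) auto
    qed (use h m in auto)
    moreover have "(\<integral>x. h x * (trapezoid (Suc n) a b x - trapezoid (Suc n) c d x) \<partial>edge_measure L) = 0" for n
    proof -
      obtain \<phi> where \<phi>: "test_fun L \<phi>" "\<And>x. deriv \<phi> x = trapezoid (Suc n) a b x - trapezoid (Suc n) c d x"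
        using test_fun_trapezoid_diff[of "Suc n" a b L c d] \<open>0 \<le> a\<close> \<open>b \<le> L\<close> \<open>0 \<le> c\<close> \<open>d \<le> L\<close> \<open>b - a = d - c\<close>
        by blast
      show ?thesis using zero[OF \<phi>(1)] by (simp add: \<phi>(2))
    qed
    ultimately have "(\<integral>x. h x * (indicator {a<..<b} x - indicator {c<..<d} x) \<partial>edge_measure L) = 0"
      by (simp add: LIMSEQ_const_iff)
    then show ?thesis
      using edge_integral_interval(3)[OF h that(1,2)] edge_integral_interval(3)[OF h that(3,4)]
      by (simp add: right_diff_distrib)
  qed
  \<comment> \<open>The constant has to be the mean: \<open>N\<close> equal cell integrals add up to
    the whole integral.\<close>
  define c where "c = (\<integral>x. h x \<partial>edge_measure L) / L"
  have "AE x in edge_measure L. h x = c"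
  proof (rule AE_const_if_cell_integrals_eq[OF L h])
    fix N j :: nat assume N: "0 < N" "j < N"
    have "cell_integral L N h i = cell_integral L N h j" if "i < N" for i
      unfolding cell_integral_def cell_def using cell_bounds[OF L that] cell_bounds[OF L N(2)]
      by (intro eq) (use N(1) in \<open>auto simp: field_simps\<close>)
    then have "(\<integral>x. h x \<partial>edge_measure L) = real N * cell_integral L N h j"
      using integral_cells[OF L N(1) h] by simp
    then show "cell_integral L N h j = c * L / real N" using L N by (simp add: c_def)
  qed
  then show ?thesis by blast
qed

section \<open>Integration by parts for primitives of integrable functions\<close>

lemma edge_integral_eq:
  fixes f :: "real \<Rightarrow> real"
  assumes "integrable (edge_measure L) f"
  shows "(\<integral>x. f x \<partial>edge_measure L) = integral {0..L} f"
  using assms by (simp add: lebesgue_integral_eq_integral integral_open_interval_real)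

lemma continuous_on_primitive:
  assumes "integrable (edge_measure L) g"
  shows "continuous_on {0..L} (\<lambda>x. integral {0..x} g :: real)"
  using edge_integral_interval(1)[OF assms, of 0 L]
  by (intro indefinite_integral_continuous_1 set_lebesgue_integral_eq_integral(1)) auto

lemma primitive_bound:
  assumes g: "integrable (edge_measure L) g" and "x \<le> L"
  shows "\<bar>integral {0..x} g :: real\<bar> \<le> (\<integral>x. \<bar>g x\<bar> \<partial>edge_measure L)"
proof -
  have "\<bar>integral {0..x} g\<bar> \<le> (\<integral>y. \<bar>g y * indicator {0<..<x} y\<bar> \<partial>edge_measure L)"
    unfolding edge_integral_interval(2)[OF g order_refl \<open>x \<le> L\<close>] by (rule integral_abs_bound)
  also have "\<dots> \<le> (\<integral>x. \<bar>g x\<bar> \<partial>edge_measure L)"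
    using g edge_integral_interval(3)[OF g order_refl \<open>x \<le> L\<close>]
    by (intro integral_mono) (auto simp: indicator_def)
  finally show ?thesis .
qed

text \<open>For continuous \<open>g\<close> this is the fundamental theorem of calculus applied to
  the product with \<phi>, which vanishes at both ends. Both sides depend continuously on
  \<open>g\<close> in L1, so density of continuous functions gives the general case.\<close>

lemma is_weak_deriv_primitive:
  assumes L: "0 < L" and g: "integrable (edge_measure L) g"
  shows "is_weak_deriv L (\<lambda>x. c + integral {0..x} g) g"
  unfolding is_weak_deriv_def
proof (intro conjI allI impI)
  have P: "integrable (edge_measure L) (\<lambda>x. integral {0..x} f)" if "integrable (edge_measure L) f" for f :: "real \<Rightarrow> real"
    by (intro integrable_edge_continuous continuous_on_primitive that)
  then show "integrable (edge_measure L) (\<lambda>x. c + integral {0..x} g)" using g by simp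
  fix \<phi> assume "test_fun L \<phi>"
  note \<phi> = test_funD[OF this]
  have contd: "continuous_on S (deriv \<phi>)" for S using \<phi>(2) continuous_on_subset by blast
  have cont: "continuous_on S \<phi>" for S using \<phi>(1) by (meson DERIV_continuous continuous_at_imp_continuous_on)
  have "bounded (deriv \<phi> ` {0..L})" "bounded (\<phi> ` {0..L})"
    by (auto intro!: compact_imp_bounded compact_continuous_image contd cont)
  then obtain B1 B2 where B12: "\<And>x. x \<in> {0..L} \<Longrightarrow> \<bar>deriv \<phi> x\<bar> \<le> B1" "\<And>x. x \<in> {0..L} \<Longrightarrow> \<bar>\<phi> x\<bar> \<le> B2"
    unfolding bounded_iff by (metis imageI real_norm_def)
  define B where "B = max B1 B2"
  have B: "\<bar>deriv \<phi> x\<bar> \<le> B" "\<bar>\<phi> x\<bar> \<le> B" if "x \<in> {0..L}" for x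
    using B12[OF that] by (auto simp: B_def)
  have B0: "0 \<le> B" using B[of 0] L by auto
  have AEL: "AE x in edge_measure L. x \<in> {0..L}"
    by (rule AE_I2) (auto simp: space_restrict_space)
  have i: "integrable (edge_measure L) (\<lambda>x. f x * deriv \<phi> x)" "integrable (edge_measure L) (\<lambda>x. f x * \<phi> x)"
    if "integrable (edge_measure L) f" for f
    using integrable_edge_mult_bounded[OF that borel_measurable_edge[OF borel_measurable_continuous_onI[OF contd]] eventually_mono[OF AEL B(1)]]
      integrable_edge_mult_bounded[OF that borel_measurable_edge[OF borel_measurable_continuous_onI[OF cont]] eventually_mono[OF AEL B(2)]]
    by simp_all
  \<comment> \<open>The defect in the integration by parts, linear in \<open>f\<close>. It vanishes
    on continuous functions and is bounded by \<open>B * (L + 1)\<close> times the L1 norm, because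
    a primitive is bounded by that norm.\<close>
  define D where "D f = (\<integral>x. integral {0..x} f * deriv \<phi> x + f x * \<phi> x \<partial>edge_measure L)" for f
  have D_int: "integrable (edge_measure L) (\<lambda>x. integral {0..x} f * deriv \<phi> x + f x * \<phi> x)"
    if "integrable (edge_measure L) f" for f
    using i P that by auto
  have D_cont: "D f = 0" if "continuous_on UNIV f" for f
  proof -
    have c: "continuous_on {0..L} f" using that continuous_on_subset by blast
    have fi: "integrable (edge_measure L) f" by (rule integrable_edge_continuous[OF c])
    have "((\<lambda>x. integral {0..x} f * deriv \<phi> x + f x * \<phi> x) has_integral
        integral {0..L} f * \<phi> L - integral {0..0} f * \<phi> 0) {0..L}"
    proof (rule fundamental_theorem_of_calculus)
      fix x assume x: "x \<in> {0..L}"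
      have "((\<lambda>x. integral {0..x} f) has_real_derivative f x) (at x within {0..L})"
        by (rule integral_has_real_derivative[OF c x])
      moreover have "(\<phi> has_real_derivative deriv \<phi> x) (at x within {0..L})"
        using \<phi>(1) by (rule has_field_derivative_at_within)
      ultimately show "((\<lambda>x. integral {0..x} f * \<phi> x) has_vector_derivative
           integral {0..x} f * deriv \<phi> x + f x * \<phi> x) (at x within {0..L})"
        unfolding has_real_derivative_iff_has_vector_derivative[symmetric]
        by (auto intro!: derivative_eq_intros)
    qed (use L in simp)
    then show ?thesis
      unfolding D_def edge_integral_eq[OF D_int[OF fi]] using \<phi>(3)[of 0] \<phi>(3)[of L] by (simp add: integral_unique)
  qed
  have D_bound: "\<bar>D f\<bar> \<le> B * (L + 1) * (\<integral>x. \<bar>f x\<bar> \<partial>edge_measure L)" if f: "integrable (edge_measure L) f" for f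
  proof -
    let ?I = "\<integral>x. \<bar>f x\<bar> \<partial>edge_measure L"
    have "\<bar>D f\<bar> \<le> (\<integral>x. \<bar>integral {0..x} f * deriv \<phi> x + f x * \<phi> x\<bar> \<partial>edge_measure L)"
      unfolding D_def by (rule integral_abs_bound)
    also have "\<dots> \<le> (\<integral>x. ?I * B + \<bar>f x\<bar> * B \<partial>edge_measure L)"
    proof (rule integral_mono_AE)
      show "AE x in edge_measure L. \<bar>integral {0..x} f * deriv \<phi> x + f x * \<phi> x\<bar> \<le> ?I * B + \<bar>f x\<bar> * B"
        using AEL
      proof eventually_elim
        case (elim x)
        have "\<bar>integral {0..x} f * deriv \<phi> x\<bar> \<le> ?I * B"
          unfolding abs_mult using elim by (intro mult_mono primitive_bound f B) auto
        moreover have "\<bar>f x * \<phi> x\<bar> \<le> \<bar>f x\<bar> * B"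
          unfolding abs_mult using elim by (intro mult_left_mono B) auto
        ultimately show ?case by linarith
      qed
    qed (use D_int[OF f] f in auto)
    also have "\<dots> = B * (L + 1) * ?I"
      using f L by (simp add: algebra_simps measure_restrict_space space_restrict_space)
    finally show ?thesis .
  qed
  have "\<bar>D g\<bar> \<le> e" if "0 < e" for e
  proof -
    \<comment> \<open>The added 1 keeps the denominator positive when \<open>B = 0\<close>.\<close>
    define \<delta> where "\<delta> = e / (B * (L + 1) + 1)"
    have pos: "0 < B * (L + 1) + 1" using B0 L by (intro add_nonneg_pos) auto
    then have "0 < \<delta>" using that by (simp add: \<delta>_def)
    then obtain f where f: "continuous_on UNIV f" "(\<integral>x. \<bar>g x - f x\<bar> \<partial>edge_measure L) < \<delta>"
      using edge_L1_dense[OF g] by metis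
    have fi: "integrable (edge_measure L) f"
      by (intro integrable_edge_continuous continuous_on_subset[OF f(1)]) simp
    have "D (\<lambda>x. g x - f x) = D g - D f"
    proof -
      have "D g - D f = (\<integral>x. (integral {0..x} g * deriv \<phi> x + g x * \<phi> x)
           - (integral {0..x} f * deriv \<phi> x + f x * \<phi> x) \<partial>edge_measure L)"
        unfolding D_def using D_int[OF g] D_int[OF fi] by simp
      also have "\<dots> = D (\<lambda>x. g x - f x)"
        unfolding D_def
      proof (rule Bochner_Integration.integral_cong[OF refl])
        fix x assume "x \<in> space (edge_measure L)"
        then have x: "x \<le> L" by (auto simp: space_restrict_space)
        have *: "integral {0..x} (\<lambda>x. g x - f x) = integral {0..x} g - integral {0..x} f"
          by (intro Henstock_Kurzweil_Integration.integral_diff set_lebesgue_integral_eq_integral(1)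
              edge_integral_interval(1)[OF g order_refl x] edge_integral_interval(1)[OF fi order_refl x])
        show "integral {0..x} g * deriv \<phi> x + g x * \<phi> x - (integral {0..x} f * deriv \<phi> x + f x * \<phi> x)
          = integral {0..x} (\<lambda>x. g x - f x) * deriv \<phi> x + (g x - f x) * \<phi> x"
          unfolding * by (simp add: algebra_simps)
      qed
      finally show ?thesis by simp
    qed
    then have "\<bar>D g\<bar> = \<bar>D (\<lambda>x. g x - f x)\<bar>" using D_cont[OF f(1)] by simp
    also have "\<dots> \<le> B * (L + 1) * (\<integral>x. \<bar>g x - f x\<bar> \<partial>edge_measure L)"
      using g fi by (intro D_bound) auto
    also have "\<dots> \<le> B * (L + 1) * \<delta>"
      using f B0 L by (intro mult_left_mono) auto
    also have "\<dots> \<le> (B * (L + 1) + 1) * \<delta>"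
      using \<open>0 < \<delta>\<close> by (intro mult_right_mono) auto
    also have "\<dots> = e" using pos by (simp add: \<delta>_def)
    finally show ?thesis .
  qed
  then have "D g = 0" by (metis abs_le_zero_iff field_le_epsilon add_0 )
  then have "(\<integral>x. integral {0..x} g * deriv \<phi> x \<partial>edge_measure L) = - (\<integral>x. g x * \<phi> x \<partial>edge_measure L)"
    unfolding D_def using i P g by simp
  moreover have "(\<integral>x. c * deriv \<phi> x \<partial>edge_measure L) = 0"
  proof -
    have "(deriv \<phi> has_integral \<phi> L - \<phi> 0) {0..L}"
      using \<phi>(1) L by (intro fundamental_theorem_of_calculus)
        (auto simp: has_real_derivative_iff_has_vector_derivative[symmetric] intro: has_field_derivative_at_within)
    then have "integral {0..L} (deriv \<phi>) = 0" using \<phi>(3)[of 0] \<phi>(3)[of L] by (simp add: integral_unique)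
    then show ?thesis using edge_integral_eq[of L "deriv \<phi>"] integrable_edge_continuous[OF contd] by simp
  qed
  ultimately show "(\<integral>x. (c + integral {0..x} g) * deriv \<phi> x \<partial>edge_measure L) = - (\<integral>x. g x * \<phi> x \<partial>edge_measure L)"
    using i[OF P[OF g]] i(1)[of "\<lambda>_. c"] by (simp add: distrib_right)
qed (rule g)

section \<open>Fields on the nodes of a subdivided graph\<close>

text \<open>\<open>c\<close> is the least value with at most half of the indices strictly above it.
  If more than half were strictly below \<open>c\<close>, the greatest value among those would be a
  smaller one with the same property.\<close>

lemma exists_median:
  fixes b :: "'a \<Rightarrow> real"
  assumes I: "finite I" "I \<noteq> {}"
  obtains c where "c \<in> b ` I" "2 * card {i\<in>I. c < b i} \<le> card I" "2 * card {i\<in>I. b i < c} \<le> card I"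
proof -
  define S where "S = {x \<in> b ` I. 2 * card {i\<in>I. x < b i} \<le> card I}"
  have fin: "finite S" using I by (auto simp: S_def)
  define M where "M = Max (b ` I)"
  have "{i\<in>I. M < b i} = {}" using I by (auto simp: not_less M_def)
  then have "card {i\<in>I. M < b i} = 0" by (simp only: card.empty)
  moreover have "M \<in> b ` I" unfolding M_def using I by (intro Max_in) auto
  ultimately have "M \<in> S" unfolding S_def by simp
  then have ne: "S \<noteq> {}" by auto
  define c where "c = Min S"
  have cS: "c \<in> S" unfolding c_def using fin ne by (rule Min_in)
  have "2 * card {i\<in>I. b i < c} \<le> card I"
  proof (rule ccontr)
    assume *: "\<not> 2 * card {i\<in>I. b i < c} \<le> card I"
    define B where "B = b ` {i\<in>I. b i < c}"
    have "card {i\<in>I. b i < c} \<noteq> 0" using * by linarith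
    then have "{i\<in>I. b i < c} \<noteq> {}" by (intro notI) (simp only: card.empty)
    then have B: "finite B" "B \<noteq> {}" using I by (auto simp: B_def)
    define c' where "c' = Max B"
    have c'B: "c' \<in> B" unfolding c'_def using B by (rule Max_in)
    have lt: "b i < c \<longleftrightarrow> b i \<le> c'" if "i \<in> I" for i
    proof
      show "b i \<le> c'" if "b i < c" using \<open>i \<in> I\<close> that B unfolding c'_def B_def by (intro Max_ge) auto
      show "b i < c" if "b i \<le> c'" using that c'B by (auto simp: B_def)
    qed
    have "{i\<in>I. c' < b i} = I - {i\<in>I. b i < c}" using lt by (auto simp: not_less not_le)
    then have "card {i\<in>I. c' < b i} = card I - card {i\<in>I. b i < c}"
      using I by (simp add: card_Diff_subset)
    then have "2 * card {i\<in>I. c' < b i} \<le> card I" using * by linarith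
    then have "c' \<in> S" using c'B by (auto simp: S_def B_def)
    then have "c \<le> c'" unfolding c_def using fin by (intro Min_le)
    then show False using c'B by (auto simp: B_def)
  qed
  with cS show thesis by (intro that[of c]) (auto simp: S_def)
qed

text \<open>
  Balanced weights that are \<open>1\<close> above a median and \<open>-1\<close> below it are optimal for all superlevel
  sets at once.
\<close>

lemma exists_calibrating_weights:
  fixes b :: "'a \<Rightarrow> real"
  assumes I: "finite I"
  shows "\<exists>\<sigma> :: 'a \<Rightarrow> real. (\<forall>i\<in>I. \<bar>\<sigma> i\<bar> \<le> 1) \<and> sum \<sigma> I = 0 \<and>
    (\<forall>t \<tau>. (\<forall>i\<in>I. \<bar>\<tau> i\<bar> \<le> 1) \<longrightarrow> sum \<tau> I = 0 \<longrightarrow>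
       (\<Sum>i\<in>I. of_bool (t < b i) * \<tau> i) \<le> (\<Sum>i\<in>I. of_bool (t < b i) * \<sigma> i))"
proof (cases "I = {}")
  case False
  then obtain c where c: "c \<in> b ` I" and above: "2 * card {i\<in>I. c < b i} \<le> card I"
    and below: "2 * card {i\<in>I. b i < c} \<le> card I"
    using exists_median[OF I] by metis
  let ?A = "{i\<in>I. c < b i}" and ?B = "{i\<in>I. b i < c}" and ?E = "{i\<in>I. b i = c}"
  have fin: "finite ?A" "finite ?B" "finite ?E" using I by auto
  have split: "sum f I = sum f ?A + sum f ?B + sum f ?E" for f :: "'a \<Rightarrow> real"
  proof -
    have "I = (?A \<union> ?B) \<union> ?E" by auto
    then have "sum f I = sum f ((?A \<union> ?B) \<union> ?E)" by simp
    also have "\<dots> = sum f (?A \<union> ?B) + sum f ?E" by (rule sum.union_disjoint) (use fin in auto)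
    also have "sum f (?A \<union> ?B) = sum f ?A + sum f ?B" by (rule sum.union_disjoint) (use fin in auto)
    finally show ?thesis .
  qed
  have card: "real (card I) = real (card ?A) + real (card ?B) + real (card ?E)"
    using split[of "\<lambda>_. 1"] by simp
  have E0: "0 < real (card ?E)" using c fin by (auto simp: card_gt_0_iff)
  \<comment> \<open>The weight on ties that makes the total vanish. That it has modulus at most 1 is
    exactly the pair of median inequalities.\<close>
  define k where "k = (real (card ?B) - real (card ?A)) / real (card ?E)"
  define \<sigma> where "\<sigma> i = (if c < b i then 1 else if b i < c then - 1 else k)" for i
  have k: "\<bar>k\<bar> \<le> 1"
    unfolding k_def abs_le_iff using E0 card above below by (simp add: divide_simps)
  have \<sigma>1: "\<forall>i\<in>I. \<bar>\<sigma> i\<bar> \<le> 1" using k by (simp add: \<sigma>_def)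
  have sA: "sum \<sigma> ?A = card ?A" "sum \<sigma> ?B = - card ?B" "sum \<sigma> ?E = card ?E * k"
    by (simp_all add: \<sigma>_def)
  have \<sigma>0: "sum \<sigma> I = 0" unfolding split sA using E0 by (simp add: k_def)
  have "(\<Sum>i\<in>I. of_bool (t < b i) * \<tau> i) \<le> (\<Sum>i\<in>I. of_bool (t < b i) * \<sigma> i)"
    if \<tau>: "\<forall>i\<in>I. \<bar>\<tau> i\<bar> \<le> 1" "sum \<tau> I = 0" for t and \<tau> :: "'a \<Rightarrow> real"
  proof (cases "c \<le> t")
    case True
    have "of_bool (t < b i) * \<tau> i \<le> of_bool (t < b i) * \<sigma> i" if "i \<in> I" for i
      using \<tau>(1)[rule_format, OF that] True by (auto simp: \<sigma>_def)
    then show ?thesis by (rule sum_mono)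
  next
    \<comment> \<open>For t below the median the termwise comparison fails on the superlevel set. By
      balance, its sum is minus that over the complement, where \<sigma> is -1 throughout.\<close>
    case False
    have eq: "(\<Sum>i\<in>I. of_bool (t < b i) * \<rho> i) = - (\<Sum>i\<in>I. of_bool (b i \<le> t) * \<rho> i)"
      if "sum \<rho> I = 0" for \<rho> :: "'a \<Rightarrow> real"
    proof -
      have "(\<Sum>i\<in>I. of_bool (t < b i) * \<rho> i) + (\<Sum>i\<in>I. of_bool (b i \<le> t) * \<rho> i) = sum \<rho> I"
        unfolding sum.distrib[symmetric] by (intro sum.cong) auto
      then show ?thesis using that by simp
    qed
    have "of_bool (b i \<le> t) * \<sigma> i \<le> of_bool (b i \<le> t) * \<tau> i" if "i \<in> I" for i
      using \<tau>(1)[rule_format, OF that] False by (auto simp: \<sigma>_def)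
    then have "(\<Sum>i\<in>I. of_bool (b i \<le> t) * \<sigma> i) \<le> (\<Sum>i\<in>I. of_bool (b i \<le> t) * \<tau> i)" by (rule sum_mono)
    then show ?thesis unfolding eq[OF \<sigma>0] eq[OF \<tau>(2)] by simp
  qed
  with \<sigma>1 \<sigma>0 show ?thesis by blast
qed simp

lemma sum_by_parts:
  fixes a r :: "nat \<Rightarrow> real"
  shows "(\<Sum>j<Suc m. a j * (r (Suc j) - r j)) = a m * r (Suc m) - a 0 * r 0 + (\<Sum>j<m. (a j - a (Suc j)) * r (Suc j))"
  by (induction m) (auto simp: algebra_simps)

context connected_metric_graph
begin

lemma sum_arcs_head: "(\<Sum>v\<in>verts G. \<Sum>e\<in>in_arcs G v. f e) = (\<Sum>e\<in>arcs G. f e)"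
  unfolding in_arcs_def by (rule sum.group) auto

lemma sum_arcs_tail: "(\<Sum>v\<in>verts G. \<Sum>e\<in>out_arcs G v. f e) = (\<Sum>e\<in>arcs G. f e)"
  unfolding out_arcs_def by (rule sum.group) auto

lemma sum_incident_edges:
  "(\<Sum>e\<in>incident_edges G v. if head G e = v then f e else g e)
     = (\<Sum>e\<in>in_arcs G v. f e) + (\<Sum>e\<in>out_arcs G v. g e)"
proof -
  have "in_arcs G v \<inter> out_arcs G v = {}" by (auto, metis no_loops)
  then have "(\<Sum>e\<in>incident_edges G v. if head G e = v then f e else g e)
     = (\<Sum>e\<in>in_arcs G v. if head G e = v then f e else g e) + (\<Sum>e\<in>out_arcs G v. if head G e = v then f e else g e)"
    unfolding incident_edges_def by (intro sum.union_disjoint) auto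
  also have "\<dots> = (\<Sum>e\<in>in_arcs G v. f e) + (\<Sum>e\<in>out_arcs G v. g e)"
    by (intro arg_cong2[where f="(+)"] sum.cong) (auto, metis no_loops)
  finally show ?thesis .
qed

text \<open>The discrete counterpart of a unit field: values at the nodes 0 to \<open>N\<close> of
  each edge in the direction of its orientation, with Kirchhoff's law written as inflow at heads
  equal to outflow at tails.\<close>

definition node_field :: "nat \<Rightarrow> ('e \<Rightarrow> nat \<Rightarrow> real) \<Rightarrow> bool" where
  "node_field N r \<longleftrightarrow> (\<forall>e\<in>arcs G. \<forall>j\<le>N. \<bar>r e j\<bar> \<le> 1) \<and>
     (\<forall>v\<in>verts G. (\<Sum>e\<in>in_arcs G v. r e N) = (\<Sum>e\<in>out_arcs G v. r e 0))"

text \<open>The integral of \<open>u z'\<close> for cellwise constant \<open>u\<close> and piecewise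
  linear \<open>z\<close>: the cell length cancels against the denominator of the slope.\<close>

definition node_pairing :: "nat \<Rightarrow> ('e \<Rightarrow> nat \<Rightarrow> real) \<Rightarrow> ('e \<Rightarrow> nat \<Rightarrow> real) \<Rightarrow> real" where
  "node_pairing N a r = (\<Sum>e\<in>arcs G. \<Sum>j<N. a e j * (r e (Suc j) - r e j))"

text \<open>Regrouping by nodes lets each nodal value occur once, and Kirchhoff's law couples only
  the values around one vertex. Maximization over fields thereby splits into one problem per node.
  With \<open>Suc m\<close> cells the interior nodes are 1 to \<open>m\<close>, and the cell at the
  head has index \<open>m\<close>.\<close>

lemma node_pairing_by_parts:
  "node_pairing (Suc m) a r =
     (\<Sum>v\<in>verts G. \<Sum>e\<in>incident_edges G v.
        (if head G e = v then a e m else a e 0) * (if head G e = v then r e (Suc m) else - r e 0))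
   + (\<Sum>e\<in>arcs G. \<Sum>j<m. (a e j - a e (Suc j)) * r e (Suc j))"
proof -
  have "(\<Sum>e\<in>incident_edges G v. (if head G e = v then a e m else a e 0) * (if head G e = v then r e (Suc m) else - r e 0))
     = (\<Sum>e\<in>in_arcs G v. a e m * r e (Suc m)) + (\<Sum>e\<in>out_arcs G v. - (a e 0 * r e 0))" for v
    unfolding sum_incident_edges[symmetric] by (intro sum.cong) auto
  then show ?thesis
    unfolding node_pairing_def sum_by_parts
    by (simp add: sum.distrib sum_arcs_head sum_arcs_tail sum_negf sum_subtractf)
qed

text \<open>The order of quantifiers is the point: \<open>s\<close> is chosen before the level t and
  is optimal for all of them. After summation by parts it can be chosen node by node.\<close>

lemma exists_calibrating_field:
  fixes a :: "'e \<Rightarrow> nat \<Rightarrow> real"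
  shows "\<exists>s. node_field (Suc m) s \<and> (\<forall>t r. node_field (Suc m) r \<longrightarrow>
    node_pairing (Suc m) (\<lambda>e j. of_bool (t < a e j)) r \<le> node_pairing (Suc m) (\<lambda>e j. of_bool (t < a e j)) s)"
proof -
  let ?b = "\<lambda>v e. if head G e = v then a e m else a e 0"
  have fin: "finite (incident_edges G v)" for v by (auto simp: incident_edges_def)
  define calib where "calib v \<sigma> \<longleftrightarrow> (\<forall>e\<in>incident_edges G v. \<bar>\<sigma> e\<bar> \<le> 1) \<and> sum \<sigma> (incident_edges G v) = 0 \<and>
    (\<forall>t \<tau>. (\<forall>e\<in>incident_edges G v. \<bar>\<tau> e\<bar> \<le> 1) \<longrightarrow> sum \<tau> (incident_edges G v) = 0 \<longrightarrow>
       (\<Sum>e\<in>incident_edges G v. of_bool (t < ?b v e) * \<tau> e) \<le> (\<Sum>e\<in>incident_edges G v. of_bool (t < ?b v e) * \<sigma> e))"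
    for v and \<sigma> :: "'e \<Rightarrow> real"
  have "\<forall>v. \<exists>\<sigma>. calib v \<sigma>"
    unfolding calib_def by (intro allI exists_calibrating_weights fin)
  then obtain \<sigma> where \<sigma>: "\<And>v. calib v (\<sigma> v)" by metis
  have \<sigma>1: "\<And>v e. e \<in> incident_edges G v \<Longrightarrow> \<bar>\<sigma> v e\<bar> \<le> 1"
    and \<sigma>0: "\<And>v. sum (\<sigma> v) (incident_edges G v) = 0"
    and opt: "\<And>v t \<tau>. \<forall>e\<in>incident_edges G v. \<bar>\<tau> e\<bar> \<le> 1 \<Longrightarrow> sum \<tau> (incident_edges G v) = 0 \<Longrightarrow>
       (\<Sum>e\<in>incident_edges G v. of_bool (t < ?b v e) * \<tau> e) \<le> (\<Sum>e\<in>incident_edges G v. of_bool (t < ?b v e) * \<sigma> v e)"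
    using \<sigma> unfolding calib_def by blast+
  \<comment> \<open>The weights \<sigma> are outward values, hence the sign change at the tail.
    Interior node j separates the cells j - 1 and j.\<close>
  define s where "s e j = (if j = 0 then - \<sigma> (tail G e) e else if j = Suc m then \<sigma> (head G e) e
     else sgn (a e (j - 1) - a e j))" for e j
  have \<tau>_s: "(if head G e = v then s e (Suc m) else - s e 0) = \<sigma> v e" if "e \<in> incident_edges G v" for e v
    using that by (auto simp: s_def incident_edges_def)
  have balance: "(\<Sum>e\<in>incident_edges G v. if head G e = v then r e (Suc m) else - r e 0)
      = (\<Sum>e\<in>in_arcs G v. r e (Suc m)) - (\<Sum>e\<in>out_arcs G v. r e 0)" for r :: "'e \<Rightarrow> nat \<Rightarrow> real" and v
    by (simp add: sum_incident_edges sum_negf)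
  have "node_field (Suc m) s"
    unfolding node_field_def
  proof (intro conjI ballI allI impI)
    fix e j assume e: "e \<in> arcs G"
    have "e \<in> incident_edges G (tail G e)" "e \<in> incident_edges G (head G e)"
      using e by (auto simp: incident_edges_def)
    then show "\<bar>s e j\<bar> \<le> 1" using \<sigma>1 by (auto simp: s_def sgn_if)
  next
    fix v assume "v \<in> verts G"
    have "(\<Sum>e\<in>incident_edges G v. if head G e = v then s e (Suc m) else - s e 0) = 0"
      using \<tau>_s \<sigma>0[of v] by simp
    then show "(\<Sum>e\<in>in_arcs G v. s e (Suc m)) = (\<Sum>e\<in>out_arcs G v. s e 0)" unfolding balance by simp
  qed
  moreover have "node_pairing (Suc m) (\<lambda>e j. of_bool (t < a e j)) r \<le> node_pairing (Suc m) (\<lambda>e j. of_bool (t < a e j)) s"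
    if r: "node_field (Suc m) r" for t r
    unfolding node_pairing_by_parts
  proof (rule add_mono; rule sum_mono)
    fix v assume v: "v \<in> verts G"
    have *: "(if head G e = v then of_bool (t < a e m) else of_bool (t < a e 0)) = (of_bool (t < ?b v e) :: real)" for e
      by simp
    have "(\<Sum>e\<in>incident_edges G v. of_bool (t < ?b v e) * (if head G e = v then r e (Suc m) else - r e 0))
      \<le> (\<Sum>e\<in>incident_edges G v. of_bool (t < ?b v e) * \<sigma> v e)"
    proof (rule opt)
      show "\<forall>e\<in>incident_edges G v. \<bar>if head G e = v then r e (Suc m) else - r e 0\<bar> \<le> 1"
        using r by (auto simp: node_field_def incident_edges_def)
      show "(\<Sum>e\<in>incident_edges G v. if head G e = v then r e (Suc m) else - r e 0) = 0"
        unfolding balance using r v by (simp add: node_field_def)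
    qed
    also have "\<dots> = (\<Sum>e\<in>incident_edges G v. of_bool (t < ?b v e) * (if head G e = v then s e (Suc m) else - s e 0))"
      using \<tau>_s by (intro sum.cong) auto
    finally show "(\<Sum>e\<in>incident_edges G v. (if head G e = v then of_bool (t < a e m) else of_bool (t < a e 0)) * (if head G e = v then r e (Suc m) else - r e 0))
      \<le> (\<Sum>e\<in>incident_edges G v. (if head G e = v then of_bool (t < a e m) else of_bool (t < a e 0)) * (if head G e = v then s e (Suc m) else - s e 0))"
      unfolding * .
  next
    \<comment> \<open>The jump of a superlevel indicator is either 0 or has the sign of the jump of
      \<open>a\<close>, so one sign is optimal for every t.\<close>
    fix e assume e: "e \<in> arcs G"
    show "(\<Sum>j<m. (of_bool (t < a e j) - of_bool (t < a e (Suc j))) * r e (Suc j))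
       \<le> (\<Sum>j<m. (of_bool (t < a e j) - of_bool (t < a e (Suc j))) * s e (Suc j))"
    proof (rule sum_mono)
      fix j assume "j \<in> {..<m}"
      with e have "\<bar>r e (Suc j)\<bar> \<le> 1" "s e (Suc j) = sgn (a e j - a e (Suc j))"
        using r by (auto simp: node_field_def s_def)
      then show "(of_bool (t < a e j) - of_bool (t < a e (Suc j))) * r e (Suc j)
         \<le> (of_bool (t < a e j) - of_bool (t < a e (Suc j))) * s e (Suc j)"
        by (cases "t < a e j"; cases "t < a e (Suc j)") (auto simp: sgn_if)
    qed
  qed
  ultimately show ?thesis by blast
qed

section \<open>Edge flows with prescribed divergence on a connected graph\<close>

definition feasible_supply :: "('v \<Rightarrow> real) \<Rightarrow> bool" where
  "feasible_supply b \<longleftrightarrow> (\<exists>c. \<forall>v\<in>verts G. (\<Sum>e\<in>in_arcs G v. c e) - (\<Sum>e\<in>out_arcs G v. c e) = b v)"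

lemma feasible_supply_scale: "feasible_supply b \<Longrightarrow> feasible_supply (\<lambda>v. k * b v)"
proof -
  assume "feasible_supply b"
  then obtain c where "\<forall>v\<in>verts G. (\<Sum>e\<in>in_arcs G v. c e) - (\<Sum>e\<in>out_arcs G v. c e) = b v"
    unfolding feasible_supply_def by blast
  then show ?thesis unfolding feasible_supply_def
    by (intro exI[of _ "\<lambda>e. k * c e"]) (auto simp: sum_distrib_left[symmetric] right_diff_distrib[symmetric])
qed

lemma feasible_supply_add:
  assumes "feasible_supply b" "feasible_supply b'"
  shows "feasible_supply (\<lambda>v. b v + b' v)"
proof -
  obtain c c' where "\<forall>v\<in>verts G. (\<Sum>e\<in>in_arcs G v. c e) - (\<Sum>e\<in>out_arcs G v. c e) = b v"
    "\<forall>v\<in>verts G. (\<Sum>e\<in>in_arcs G v. c' e) - (\<Sum>e\<in>out_arcs G v. c' e) = b' v"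
    using assms unfolding feasible_supply_def by blast
  then show ?thesis unfolding feasible_supply_def
    by (intro exI[of _ "\<lambda>e. c e + c' e"]) (simp add: sum.distrib add_diff_add)
qed

lemma feasible_supply_sum:
  assumes "finite I" "\<And>i. i \<in> I \<Longrightarrow> feasible_supply (b i)"
  shows "feasible_supply (\<lambda>v. \<Sum>i\<in>I. b i v)"
  using assms
proof (induction I rule: finite_induct)
  case empty
  show ?case unfolding feasible_supply_def by (auto intro: exI[of _ "\<lambda>_. 0"])
qed (simp add: feasible_supply_add)

lemma feasible_supply_arc:
  assumes "e \<in> arcs G"
  shows "feasible_supply (\<lambda>v. of_bool (v = head G e) - of_bool (v = tail G e))"
  unfolding feasible_supply_def
proof (intro exI[of _ "\<lambda>f. of_bool (f = e)"] ballI)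
  fix v
  show "(\<Sum>f\<in>in_arcs G v. of_bool (f = e)) - (\<Sum>f\<in>out_arcs G v. of_bool (f = e))
     = (of_bool (v = head G e) - of_bool (v = tail G e) :: real)"
    using assms finite_in_arcs[of v] finite_out_arcs[of v] by (auto simp: of_bool_def sum.delta)
qed

text \<open>A unit flow along an undirected path from \<open>u\<close> to \<open>w\<close>: the
  divergences of the single arcs telescope, and an arc traversed against its orientation carries
  -1.\<close>

lemma feasible_supply_path:
  assumes "u \<in> verts G" "w \<in> verts G"
  shows "feasible_supply (\<lambda>v. of_bool (v = w) - of_bool (v = u))"
proof -
  have "u \<rightarrow>\<^sup>*\<^bsub>with_proj (mk_symmetric G)\<^esub> w"
    using connected assms by (auto simp: Digraph_Component.connected_def strongly_connected_def)
  then have "(u, w) \<in> (arcs_ends (with_proj (mk_symmetric G)))\<^sup>*" by (rule reachable_rtranclI)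
  then show ?thesis
  proof (induction rule: rtrancl_induct)
    case base
    show ?case unfolding feasible_supply_def by (auto intro: exI[of _ "\<lambda>_. 0"])
  next
    case (step x y)
    then have "(x, y) \<in> parcs (mk_symmetric G)" by simp
    then obtain e where e: "e \<in> arcs G" "(x, y) = (tail G e, head G e) \<or> (x, y) = (head G e, tail G e)"
      by (auto simp: parcs_mk_symmetric)
    have "feasible_supply (\<lambda>v. of_bool (v = y) - of_bool (v = x))"
      using e(2) feasible_supply_arc[OF e(1)] feasible_supply_scale[OF feasible_supply_arc[OF e(1)], of "-1"] by auto
    from feasible_supply_add[OF step.IH this] show ?case by simp
  qed
qed

text \<open>Route the supply of each vertex to a fixed root \<open>u\<close>. The contributions at
  the root cancel because the total supply is 0.\<close>

lemma feasible_supply_if_balanced: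
  assumes "(\<Sum>v\<in>verts G. b v) = 0"
  shows "feasible_supply b"
proof -
  obtain u where u: "u \<in> verts G"
    using connected by (auto simp: Digraph_Component.connected_def strongly_connected_def)
  have "feasible_supply (\<lambda>v. \<Sum>w\<in>verts G. b w * (of_bool (v = w) - of_bool (v = u)))"
    by (intro feasible_supply_sum feasible_supply_scale feasible_supply_path u) auto
  moreover have "(\<Sum>w\<in>verts G. b w * (of_bool (v = w) - of_bool (v = u))) = b v" if "v \<in> verts G" for v
  proof -
    have "(\<Sum>w\<in>verts G. b w * (of_bool (v = w) - of_bool (v = u)))
      = (\<Sum>w\<in>verts G. b w * of_bool (v = w)) - (\<Sum>w\<in>verts G. b w) * of_bool (v = u)"
      by (simp add: right_diff_distrib sum_subtractf sum_distrib_right)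
    also have "(\<Sum>w\<in>verts G. b w * of_bool (v = w)) = b v"
      using that by (simp add: of_bool_def if_distrib sum.delta cong: if_cong)
    finally show ?thesis using assms by simp
  qed
  ultimately show ?thesis unfolding feasible_supply_def by simp
qed

end

section \<open>Sobolev fields on the graph\<close>

text \<open>A closed set of full measure contains the open edge and hence its closure. This carries
  almost everywhere information on Sobolev functions to the endpoints.\<close>

lemma edge_AE_imp_all:
  assumes L: "0 < L" and cl: "closed {x\<in>{0..L}. P x}"
    and ae: "AE x in edge_measure L. P x" and x: "x \<in> {0..L}"
  shows "P x"
proof -
  have "AE x\<in>{0<..<L} in lebesgue. x \<in> {x\<in>{0..L}. P x}"
    using ae by (auto simp: AE_restrict_space_iff elim!: eventually_mono)
  then have "{0<..<L} \<subseteq> {x\<in>{0..L}. P x}"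
    using mem_closed_if_AE_lebesgue_open[OF open_greaterThanLessThan cl] by blast
  then have "closure {0<..<L} \<subseteq> {x\<in>{0..L}. P x}"
    using cl by (rule closure_minimal)
  then show ?thesis using x L by (auto simp: closure_greaterThanLessThan)
qed

lemma continuous_AE_eq:
  fixes f g :: "real \<Rightarrow> real"
  assumes "0 < L" "continuous_on {0..L} f" "continuous_on {0..L} g"
    and "AE x in edge_measure L. f x = g x" "x \<in> {0..L}"
  shows "f x = g x"
proof (rule edge_AE_imp_all[OF assms(1) _ assms(4,5)])
  have "closed ({0..L} \<inter> (\<lambda>x. f x - g x) -` {0})"
    by (intro continuous_closed_preimage continuous_intros assms)
  moreover have "{0..L} \<inter> (\<lambda>x. f x - g x) -` {0} = {x\<in>{0..L}. f x = g x}" by auto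
  ultimately show "closed {x\<in>{0..L}. f x = g x}" by simp
qed

text \<open>By the lemma of du Bois-Reymond, \<open>f\<close> differs from the primitive of its
  chosen weak derivative by a constant almost everywhere. This gives a witness for the choice in
  \<open>cont_rep\<close>; the constant cancels in increments.\<close>

lemma weak_deriv_cont_rep:
  assumes L: "0 < L" and ex: "\<exists>g. is_weak_deriv L f g"
  shows "is_weak_deriv L f (weak_deriv L f)"
    and "integrable (edge_measure L) (weak_deriv L f)"
    and "continuous_on {0..L} (cont_rep L f)"
    and "AE x in edge_measure L. cont_rep L f x = f x"
    and "\<And>a b. 0 \<le> a \<Longrightarrow> a \<le> b \<Longrightarrow> b \<le> L \<Longrightarrow> integral {a..b} (weak_deriv L f) = cont_rep L f b - cont_rep L f a"
proof -
  let ?w = "weak_deriv L f" and ?G = "cont_rep L f"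
  show wd: "is_weak_deriv L f ?w" unfolding weak_deriv_def using ex by (rule someI_ex)
  then show w: "integrable (edge_measure L) ?w" by (simp add: is_weak_deriv_def)
  have f: "integrable (edge_measure L) f" using wd by (simp add: is_weak_deriv_def)
  define F where "F x = 0 + integral {0..x} ?w" for x
  have Fd: "is_weak_deriv L F ?w" unfolding F_def by (rule is_weak_deriv_primitive[OF L w])
  then have Fi: "integrable (edge_measure L) F" by (simp add: is_weak_deriv_def)
  have contF: "continuous_on {0..L} F" unfolding F_def by (intro continuous_intros continuous_on_primitive w)
  have "\<exists>c. AE x in edge_measure L. f x - F x = c"
  proof (rule AE_const_if_weak_deriv_0[OF L])
    fix \<phi> assume t: "test_fun L \<phi>"
    have m: "deriv \<phi> \<in> borel_measurable (edge_measure L)"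
      by (intro borel_measurable_edge borel_measurable_continuous_onI test_funD(2)[OF t])
    have "bounded (deriv \<phi> ` {0..L})"
      by (intro compact_imp_bounded compact_continuous_image continuous_on_subset[OF test_funD(2)[OF t]]) auto
    then obtain B where "\<And>x. x \<in> {0..L} \<Longrightarrow> \<bar>deriv \<phi> x\<bar> \<le> B" unfolding bounded_iff by (metis imageI real_norm_def)
    then have ae: "AE x in edge_measure L. \<bar>deriv \<phi> x\<bar> \<le> B" by (intro AE_I2) (auto simp: space_restrict_space)
    show "(\<integral>x. (f x - F x) * deriv \<phi> x \<partial>edge_measure L) = 0"
      using wd Fd t integrable_edge_mult_bounded[OF f m ae] integrable_edge_mult_bounded[OF Fi m ae]
      by (simp add: is_weak_deriv_def left_diff_distrib)
  qed (use f Fi in simp)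
  then obtain c where c: "AE x in edge_measure L. f x - F x = c" by blast
  have cF: "continuous_on {0..L} (\<lambda>x. c + F x)" by (intro continuous_intros contF)
  have "\<exists>g. continuous_on {0..L} g \<and> (AE x in edge_measure L. g x = f x)"
    using cF c by (intro exI[of _ "\<lambda>x. c + F x"]) (auto elim!: eventually_mono)
  then have G: "continuous_on {0..L} ?G \<and> (AE x in edge_measure L. ?G x = f x)"
    unfolding cont_rep_def by (rule someI_ex)
  then show contG: "continuous_on {0..L} ?G" and aeG: "AE x in edge_measure L. ?G x = f x" by auto
  have "AE x in edge_measure L. ?G x = c + F x" using aeG c by eventually_elim auto
  then have GF: "?G x = c + F x" if "x \<in> {0..L}" for x
    using continuous_AE_eq[OF L contG cF _ that] by blast
  fix a b :: real assume ab: "0 \<le> a" "a \<le> b" "b \<le> L"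
  have "?w integrable_on {0..b}"
    using ab by (intro set_lebesgue_integral_eq_integral(1) edge_integral_interval(1)[OF w]) auto
  then have "integral {0..a} ?w + integral {a..b} ?w = integral {0..b} ?w"
    using ab by (intro Henstock_Kurzweil_Integration.integral_combine) auto
  then show "integral {a..b} ?w = ?G b - ?G a" using ab GF[of a] GF[of b] by (simp add: F_def)
qed

text \<open>The chosen objects are the expected ones: the representative by continuity, the
  derivative because its integral over each cell is an increment of the representative.\<close>

lemma primitive_weak_deriv_cont_rep:
  assumes L: "0 < L" and w: "integrable (edge_measure L) w"
  shows "x \<in> {0..L} \<Longrightarrow> cont_rep L (\<lambda>x. c + integral {0..x} w) x = c + integral {0..x} w"
    and "AE x in edge_measure L. weak_deriv L (\<lambda>x. c + integral {0..x} w) x = w x"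
proof -
  let ?f = "\<lambda>x. c + integral {0..x} w"
  have "\<exists>g. is_weak_deriv L ?f g" using is_weak_deriv_primitive[OF L w] by blast
  note W = weak_deriv_cont_rep[OF L this]
  have cont: "continuous_on {0..L} ?f" by (intro continuous_intros continuous_on_primitive w)
  show eq: "cont_rep L ?f x = ?f x" if "x \<in> {0..L}" for x
    using continuous_AE_eq[OF L W(3) cont W(4) that] .
  have "AE x in edge_measure L. weak_deriv L ?f x - w x = 0"
  proof (rule AE_const_if_cell_integrals_eq[OF L])
    fix N j :: nat assume N: "0 < N" "j < N"
    let ?a = "real j * L / real N" and ?b = "real (Suc j) * L / real N"
    have ab: "0 \<le> ?a" "?a \<le> ?b" "?b \<le> L" using cell_bounds[OF L N(2)] by auto
    have iw: "w integrable_on {0..?b}"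
      using ab by (intro set_lebesgue_integral_eq_integral(1) edge_integral_interval(1)[OF w]) auto
    have "integral {0..?a} w + integral {?a..?b} w = integral {0..?b} w"
      using ab iw by (intro Henstock_Kurzweil_Integration.integral_combine) auto
    then have "integral {?a..?b} (weak_deriv L ?f) = integral {?a..?b} w"
      using W(5)[OF ab] eq[of ?a] eq[of ?b] ab by auto
    then have "cell_integral L N (weak_deriv L ?f) j = cell_integral L N w j"
      using L N W(2) w by (simp add: cell_integral_eq)
    moreover have "cell_integral L N (\<lambda>x. weak_deriv L ?f x - w x) j
       = cell_integral L N (weak_deriv L ?f) j - cell_integral L N w j"
      using integrable_cell[OF L N(2) W(2)] integrable_cell[OF L N(2) w]
      by (simp add: cell_integral_def left_diff_distrib)
    ultimately show "cell_integral L N (\<lambda>x. weak_deriv L ?f x - w x) j = 0 * L / real N" by simp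
  qed (use W(2) w in simp)
  then show "AE x in edge_measure L. weak_deriv L ?f x = w x" by eventually_elim auto
qed

lemma W12_primitive:
  assumes L: "0 < L" and w: "w \<in> borel_measurable (edge_measure L)" "AE x in edge_measure L. \<bar>w x\<bar> \<le> B"
  shows "W12_fun L (\<lambda>x. c + integral {0..x} w)"
proof -
  have wi: "integrable (edge_measure L) w" using w by (rule integrable_edge_bounded)
  have cont: "continuous_on {0..L} (\<lambda>x. c + integral {0..x} w)"
    by (intro continuous_intros continuous_on_primitive wi)
  have "integrable (edge_measure L) (\<lambda>x. (w x)\<^sup>2)"
    unfolding power2_eq_square using integrable_edge_mult_bounded[OF wi w] .
  then have "L2_fun L w" using w by (simp add: L2_fun_def)
  moreover have "L2_fun L (\<lambda>x. c + integral {0..x} w)"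
    unfolding L2_fun_def
    using borel_measurable_integrable[OF integrable_edge_continuous[OF cont]]
      integrable_edge_continuous[OF continuous_on_power[OF cont]] by blast
  ultimately show ?thesis
    unfolding W12_fun_def using is_weak_deriv_primitive[OF L wi] by blast
qed

section \<open>Construction of admissible fields, and their values at the nodes\<close>

context connected_metric_graph
begin

abbreviation unit_fields :: "('e \<Rightarrow> real \<Rightarrow> real) set" where
  "unit_fields \<equiv> {z \<in> X_K G len. Linf_norm G len z \<le> 1}"

lemma sum_vertex_value:
  "(\<Sum>e\<in>incident_edges G v. vertex_value G len z e v)
     = (\<Sum>e\<in>in_arcs G v. cont_rep (len e) (z e) (len e)) - (\<Sum>e\<in>out_arcs G v. cont_rep (len e) (z e) 0)"
proof -
  have "(\<Sum>e\<in>incident_edges G v. vertex_value G len z e v)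
     = (\<Sum>e\<in>incident_edges G v. if head G e = v then cont_rep (len e) (z e) (len e) else - cont_rep (len e) (z e) 0)"
    by (intro sum.cong) (auto simp: vertex_value_def incident_edges_def)
  then show ?thesis by (simp add: sum_incident_edges sum_negf)
qed

text \<open>The source of all lower bounds for \<open>TV\<close>. A field is given by its tail
  values \<open>c\<close> and a bounded derivative \<open>w\<close>, so that neither weak
  derivatives nor chosen representatives have to be handled by its users.\<close>

lemma TV_ge_pairing:
  assumes u: "\<And>e. e \<in> arcs G \<Longrightarrow> u e \<in> borel_measurable (edge_measure (len e))"
    and w: "\<And>e. e \<in> arcs G \<Longrightarrow> w e \<in> borel_measurable (edge_measure (len e))"
      "\<And>e. e \<in> arcs G \<Longrightarrow> AE x in edge_measure (len e). \<bar>w e x\<bar> \<le> B e"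
    and kirchhoff: "\<And>v. v \<in> verts G \<Longrightarrow>
      (\<Sum>e\<in>in_arcs G v. c e + integral {0..len e} (w e)) = (\<Sum>e\<in>out_arcs G v. c e)"
    and bound: "\<And>e. e \<in> arcs G \<Longrightarrow> AE x in edge_measure (len e). \<bar>c e + integral {0..x} (w e)\<bar> \<le> 1"
  shows "ennreal \<bar>graph_integral G len (\<lambda>e x. u e x * w e x)\<bar> \<le> TV G len u"
proof -
  define z where "z e x = c e + integral {0..x} (w e)" for e x
  have wi: "integrable (edge_measure (len e)) (w e)" if "e \<in> arcs G" for e
    using w that by (intro integrable_edge_bounded) auto
  have rep: "cont_rep (len e) (z e) x = c e + integral {0..x} (w e)" if "e \<in> arcs G" "x \<in> {0..len e}" for e x
    unfolding z_def using that by (intro primitive_weak_deriv_cont_rep(1) len_pos wi)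
  have W: "W12_fun (len e) (z e)" if "e \<in> arcs G" for e
    unfolding z_def using that w by (intro W12_primitive len_pos) auto
  have "z \<in> X_K G len"
    unfolding X_K_def graph_W12_def mem_Collect_eq sum_vertex_value
  proof (intro conjI ballI)
    fix v assume v: "v \<in> verts G"
    have "(\<Sum>e\<in>in_arcs G v. cont_rep (len e) (z e) (len e)) = (\<Sum>e\<in>in_arcs G v. c e + integral {0..len e} (w e))"
      using len_pos by (intro sum.cong refl rep) (auto simp: less_imp_le)
    moreover have "(\<Sum>e\<in>out_arcs G v. cont_rep (len e) (z e) 0) = (\<Sum>e\<in>out_arcs G v. c e)"
      using rep len_pos by (intro sum.cong) (auto simp: less_imp_le)
    ultimately show "(\<Sum>e\<in>in_arcs G v. cont_rep (len e) (z e) (len e)) - (\<Sum>e\<in>out_arcs G v. cont_rep (len e) (z e) 0) = 0"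
      using kirchhoff[OF v] by simp
  qed (rule W)
  moreover have "Linf_norm G len z \<le> 1"
    unfolding Linf_norm_def
  proof (rule SUP_least)
    fix e assume e: "e \<in> arcs G"
    have "z e \<in> borel_measurable (edge_measure (len e))" using W[OF e] by (simp add: W12_fun_def L2_fun_def)
    then show "esssup (edge_measure (len e)) (\<lambda>x. ereal \<bar>z e x\<bar>) \<le> 1"
      using bound[OF e, folded z_def] by (intro esssup_I) (auto elim!: eventually_mono)
  qed
  ultimately have "ennreal \<bar>graph_integral G len (\<lambda>e x. u e x * graph_deriv len z e x)\<bar> \<le> TV G len u"
    unfolding TV_def by (intro SUP_upper) auto
  moreover have "graph_integral G len (\<lambda>e x. u e x * graph_deriv len z e x) = graph_integral G len (\<lambda>e x. u e x * w e x)"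
    unfolding graph_integral_def graph_deriv_def
  proof (rule sum.cong[OF refl])
    fix e assume e: "e \<in> arcs G"
    have ex: "\<exists>g. is_weak_deriv (len e) (z e) g"
      unfolding z_def using is_weak_deriv_primitive[OF len_pos[OF e] wi[OF e]] by blast
    have "AE x in edge_measure (len e). weak_deriv (len e) (z e) x = w e x"
      unfolding z_def by (rule primitive_weak_deriv_cont_rep(2)[OF len_pos[OF e] wi[OF e]])
    then show "(\<integral>x. u e x * weak_deriv (len e) (z e) x \<partial>edge_measure (len e)) = (\<integral>x. u e x * w e x \<partial>edge_measure (len e))"
      using u[OF e] w(1)[OF e] weak_deriv_cont_rep(2)[OF len_pos[OF e] ex]
      by (intro integral_cong_AE) (auto elim!: eventually_mono)
  qed
  ultimately show ?thesis by simp
qed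

text \<open>What is needed of an arbitrary competitor in \<open>TV\<close>. The essential bound
  holds pointwise for the continuous representative, endpoints included, by closedness.\<close>

lemma unit_fieldD:
  assumes z: "z \<in> unit_fields" and e: "e \<in> arcs G"
  shows "integrable (edge_measure (len e)) (graph_deriv len z e)"
    and "x \<in> {0..len e} \<Longrightarrow> \<bar>cont_rep (len e) (z e) x\<bar> \<le> 1"
    and "0 \<le> a \<Longrightarrow> a \<le> b \<Longrightarrow> b \<le> len e \<Longrightarrow>
      integral {a..b} (graph_deriv len z e) = cont_rep (len e) (z e) b - cont_rep (len e) (z e) a"
proof -
  have "W12_fun (len e) (z e)" using z e by (auto simp: X_K_def graph_W12_def)
  then have "\<exists>g. is_weak_deriv (len e) (z e) g" by (auto simp: W12_fun_def)
  note W = weak_deriv_cont_rep[OF len_pos[OF e] this]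
  show "integrable (edge_measure (len e)) (graph_deriv len z e)"
    unfolding graph_deriv_def by (rule W(2))
  show "0 \<le> a \<Longrightarrow> a \<le> b \<Longrightarrow> b \<le> len e \<Longrightarrow>
      integral {a..b} (graph_deriv len z e) = cont_rep (len e) (z e) b - cont_rep (len e) (z e) a"
    unfolding graph_deriv_def by (rule W(5))
  have "esssup (edge_measure (len e)) (\<lambda>x. ereal \<bar>z e x\<bar>) \<le> 1"
    using z SUP_upper[OF e, of "\<lambda>e. esssup (edge_measure (len e)) (\<lambda>x. ereal \<bar>z e x\<bar>)"]
    by (auto simp: Linf_norm_def)
  then have "AE x in edge_measure (len e). ereal \<bar>z e x\<bar> \<le> 1"
    by (intro eventually_mono[OF esssup_AE[of "\<lambda>x. ereal \<bar>z e x\<bar>" "edge_measure (len e)"]])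
      (rule order_trans)
  then have ae: "AE x in edge_measure (len e). \<bar>cont_rep (len e) (z e) x\<bar> \<le> 1"
    using W(4) by eventually_elim auto
  have cl: "closed {x\<in>{0..len e}. \<bar>cont_rep (len e) (z e) x\<bar> \<le> 1}"
  proof -
    have "closed ({0..len e} \<inter> cont_rep (len e) (z e) -` {-1..1})"
      by (intro continuous_closed_preimage W(3)) auto
    moreover have "{0..len e} \<inter> cont_rep (len e) (z e) -` {-1..1} = {x\<in>{0..len e}. \<bar>cont_rep (len e) (z e) x\<bar> \<le> 1}"
      by auto
    ultimately show ?thesis by simp
  qed
  show "\<bar>cont_rep (len e) (z e) x\<bar> \<le> 1" if "x \<in> {0..len e}"
    by (rule edge_AE_imp_all[OF len_pos[OF e] cl ae that])
qed

end

section \<open>Perimeters of sets\<close>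

context connected_metric_graph
begin

lemma char_fun_measurable:
  assumes "graph_measurable G len E" "e \<in> arcs G"
  shows "char_fun E e \<in> borel_measurable (edge_measure (len e))"
proof -
  have "char_fun E e = indicator {x. (e, x) \<in> E}" by (auto simp: char_fun_def indicator_def fun_eq_iff)
  moreover have "{x. (e, x) \<in> E} \<in> sets lebesgue" using assms by (auto simp: graph_measurable_def)
  ultimately show ?thesis by (simp add: measurable_restrict_space1)
qed

lemma char_fun_bounds: "0 \<le> char_fun E e x" "char_fun E e x \<le> 1" "\<bar>char_fun E e x\<bar> \<le> 1"
  by (auto simp: char_fun_def indicator_def)

lemma integrable_char_fun:
  "graph_measurable G len E \<Longrightarrow> e \<in> arcs G \<Longrightarrow> integrable (edge_measure (len e)) (char_fun E e)"
  by (rule integrable_edge_bounded[where B=1]) (auto simp: char_fun_measurable char_fun_bounds)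

lemma graph_length_points: "graph_length G len (points G len) = (\<Sum>e\<in>arcs G. len e)"
  unfolding graph_length_def graph_integral_def
proof (rule sum.cong[OF refl])
  fix e assume e: "e \<in> arcs G"
  have "(\<integral>x. char_fun (points G len) e x \<partial>edge_measure (len e)) = (\<integral>x. 1 \<partial>edge_measure (len e))"
    using e by (intro Bochner_Integration.integral_cong) (auto simp: char_fun_def points_def space_restrict_space)
  then show "(\<integral>x. char_fun (points G len) e x \<partial>edge_measure (len e)) = len e"
    using len_pos[OF e] by (simp add: measure_restrict_space space_restrict_space)
qed

text \<open>
  Connectedness supplies a field whose derivative is \<open>char_fun E\<close> minus its mean; pairing it
  with \<open>char_fun E\<close> gives a positive number.
\<close>

lemma Per_pos:
  assumes E: "graph_measurable G len E" and pos: "0 < graph_length G len E"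
    and less: "graph_length G len E < graph_length G len (points G len)"
  shows "0 < Per G len E"
proof -
  let ?l = "graph_length G len E" and ?T = "graph_length G len (points G len)"
  \<comment> \<open>Subtracting the mean makes the total integral of \<open>w\<close> vanish, which
    is the solvability condition for Kirchhoff's law.\<close>
  define m where "m = ?l / ?T"
  have T: "0 < ?T" using pos less by linarith
  have m: "0 \<le> m" "m < 1" using pos less T by (auto simp: m_def)
  define w where "w e x = char_fun E e x - m" for e x
  have wm: "w e \<in> borel_measurable (edge_measure (len e))" if "e \<in> arcs G" for e
    unfolding w_def using char_fun_measurable[OF E that] by measurable
  have wb: "\<bar>w e x\<bar> \<le> 1" for e x using m char_fun_bounds[of E e x] by (auto simp: w_def)
  have wi: "integrable (edge_measure (len e)) (w e)" if "e \<in> arcs G" for e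
    by (rule integrable_edge_bounded[OF wm[OF that]]) (use wb in auto)
  define I where "I e = integral {0..len e} (w e)" for e
  have I_eq: "I e = (\<integral>x. char_fun E e x \<partial>edge_measure (len e)) - m * len e" if e: "e \<in> arcs G" for e
    unfolding I_def edge_integral_eq[OF wi[OF e], symmetric] w_def
    using integrable_char_fun[OF E e] len_pos[OF e] by (simp add: measure_restrict_space space_restrict_space)
  have "(\<Sum>e\<in>arcs G. I e) = (\<Sum>e\<in>arcs G. \<integral>x. char_fun E e x \<partial>edge_measure (len e)) - m * (\<Sum>e\<in>arcs G. len e)"
    by (simp add: I_eq sum_subtractf sum_distrib_left)
  also have "\<dots> = ?l - m * ?T"
    unfolding graph_length_points by (simp add: graph_length_def graph_integral_def)
  also have "\<dots> = 0" using T by (simp add: m_def)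
  finally have I0: "(\<Sum>e\<in>arcs G. I e) = 0" .
  \<comment> \<open>The unknowns are the tail values \<open>c e\<close>. The value at the head is
    \<open>c e + I e\<close>, so Kirchhoff's law prescribes the divergence of
    \<open>c\<close>.\<close>
  have "(\<Sum>v\<in>verts G. - (\<Sum>e\<in>in_arcs G v. I e)) = 0"
    by (simp add: sum_negf sum_arcs_head I0)
  from feasible_supply_if_balanced[OF this] obtain c where
    c: "\<And>v. v \<in> verts G \<Longrightarrow> (\<Sum>e\<in>in_arcs G v. c e) - (\<Sum>e\<in>out_arcs G v. c e) = - (\<Sum>e\<in>in_arcs G v. I e)"
    unfolding feasible_supply_def by blast
  \<comment> \<open>Dividing by \<open>K\<close> normalizes the field on all edges. The summand 1
    makes \<open>K\<close> at least 1, so the division is safe and the derivative stays bounded by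
    1.\<close>
  define K where "K = 1 + (\<Sum>e\<in>arcs G. \<bar>c e\<bar> + (\<integral>x. \<bar>w e x\<bar> \<partial>edge_measure (len e)))"
  have K: "1 \<le> K" unfolding K_def by (simp add: sum_nonneg)
  have bound: "\<bar>c e + integral {0..x} (w e)\<bar> \<le> K" if e: "e \<in> arcs G" and x: "x \<le> len e" for e x
  proof -
    have "\<bar>c e + integral {0..x} (w e)\<bar> \<le> \<bar>c e\<bar> + (\<integral>x. \<bar>w e x\<bar> \<partial>edge_measure (len e))"
      using primitive_bound[OF wi[OF e] x] by linarith
    also have "\<dots> \<le> (\<Sum>e\<in>arcs G. \<bar>c e\<bar> + (\<integral>x. \<bar>w e x\<bar> \<partial>edge_measure (len e)))"
      using e by (intro member_le_sum) auto
    finally show ?thesis by (simp add: K_def)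
  qed
  have le_TV: "ennreal \<bar>graph_integral G len (\<lambda>e x. char_fun E e x * (w e x / K))\<bar> \<le> TV G len (char_fun E)"
  proof (rule TV_ge_pairing[where c="\<lambda>e. c e / K" and B="\<lambda>_. 1"])
    show "AE x in edge_measure (len e). \<bar>w e x / K\<bar> \<le> 1" for e
    proof (rule AE_I2)
      fix x
      have "\<bar>w e x\<bar> \<le> K" using wb K by (rule order_trans)
      then show "\<bar>w e x / K\<bar> \<le> 1" using K by simp
    qed
    show "(\<lambda>x. w e x / K) \<in> borel_measurable (edge_measure (len e))" if "e \<in> arcs G" for e
      using wm[OF that] by measurable
    have I': "integral {0..len e} (\<lambda>x. w e x / K) = I e / K" for e unfolding I_def by simp
    show "(\<Sum>e\<in>in_arcs G v. c e / K + integral {0..len e} (\<lambda>x. w e x / K)) = (\<Sum>e\<in>out_arcs G v. c e / K)"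
      if "v \<in> verts G" for v
      using c[OF that] unfolding I' by (simp add: sum.distrib sum_divide_distrib[symmetric] add_divide_distrib[symmetric])
    show "AE x in edge_measure (len e). \<bar>c e / K + integral {0..x} (\<lambda>x. w e x / K)\<bar> \<le> 1" if "e \<in> arcs G" for e
    proof (rule AE_I2)
      fix x assume "x \<in> space (edge_measure (len e))"
      then have "\<bar>c e + integral {0..x} (w e)\<bar> \<le> K" using that by (intro bound) (auto simp: space_restrict_space)
      then show "\<bar>c e / K + integral {0..x} (\<lambda>x. w e x / K)\<bar> \<le> 1"
        using K by (simp add: add_divide_distrib[symmetric])
    qed
  qed (use char_fun_measurable[OF E] in auto)
  have pairing: "graph_integral G len (\<lambda>e x. char_fun E e x * (w e x / K)) = (1 - m) * ?l / K"
  proof -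
    \<comment> \<open>On \<open>E\<close> the derivative \<open>w\<close> is 1 - m, and off
      \<open>E\<close> the product is 0.\<close>
    have eq: "char_fun E e x * (w e x / K) = (1 - m) / K * char_fun E e x" for e x
      by (auto simp: w_def char_fun_def indicator_def)
    show ?thesis
      unfolding graph_length_def graph_integral_def eq integral_mult_right_zero sum_distrib_left[symmetric] by simp
  qed
  have "0 < (1 - m) * ?l / K" using m pos K by simp
  then have "0 < ennreal \<bar>(1 - m) * ?l / K\<bar>" by (simp only: abs_of_pos ennreal_less_zero_iff)
  also have "\<dots> \<le> TV G len (char_fun E)" by (rule le_TV[unfolded pairing])
  finally show ?thesis unfolding Per_def .
qed

text \<open>A test function on one edge, extended by 0 to the others, vanishes at all vertices and
  is therefore an admissible field. The perimeter thus bounds the variation on each edge.\<close>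

lemma char_fun_BV:
  assumes E: "graph_measurable G len E" and fin: "Per G len E \<noteq> top"
  shows "char_fun E \<in> graph_BV G len"
  unfolding graph_BV_def BV_fun_def
proof (safe intro!: integrable_char_fun E)
  fix e assume e: "e \<in> arcs G"
  have "(\<integral>x. char_fun E e x * deriv \<phi> x \<partial>edge_measure (len e)) \<le> enn2real (Per G len E)"
    if t: "test_fun (len e) \<phi>" and \<phi>1: "\<forall>x. \<bar>\<phi> x\<bar> \<le> 1" for \<phi>
  proof -
    note \<phi> = test_funD[OF t]
    define w where "w f = (if f = e then deriv \<phi> else (\<lambda>_. 0))" for f
    have wint: "integral {0..x} (w f) = (if f = e then \<phi> x else 0)" if "0 \<le> x" for f x
    proof -
      have "(deriv \<phi> has_integral \<phi> x - \<phi> 0) {0..x}"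
        using \<phi>(1) that by (intro fundamental_theorem_of_calculus)
          (auto simp: has_real_derivative_iff_has_vector_derivative[symmetric] intro: has_field_derivative_at_within)
      then show ?thesis using \<phi>(3)[of 0] by (simp add: w_def integral_unique)
    qed
    have "bounded (deriv \<phi> ` {0..len e})"
      by (intro compact_imp_bounded compact_continuous_image continuous_on_subset[OF \<phi>(2)]) auto
    then obtain B where "\<And>x. x \<in> {0..len e} \<Longrightarrow> \<bar>deriv \<phi> x\<bar> \<le> B" unfolding bounded_iff by (metis imageI real_norm_def)
    then have B: "AE x in edge_measure (len e). \<bar>deriv \<phi> x\<bar> \<le> B" by (intro AE_I2) (auto simp: space_restrict_space)
    have "ennreal \<bar>graph_integral G len (\<lambda>f x. char_fun E f x * w f x)\<bar> \<le> TV G len (char_fun E)"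
    proof (rule TV_ge_pairing[where c="\<lambda>_. 0" and B="\<lambda>f. if f = e then B else 0"])
      show "w f \<in> borel_measurable (edge_measure (len f))" for f
        unfolding w_def using borel_measurable_edge[OF borel_measurable_continuous_onI[OF \<phi>(2)]] by simp
      show "AE x in edge_measure (len f). \<bar>w f x\<bar> \<le> (if f = e then B else 0)" for f
        using B by (auto simp: w_def)
      show "(\<Sum>f\<in>in_arcs G v. 0 + integral {0..len f} (w f)) = (\<Sum>f\<in>out_arcs G v. 0)" for v
        using \<phi>(3)[of "len e"] by (auto simp: wint less_imp_le[OF len_pos] intro!: sum.neutral)
      show "AE x in edge_measure (len f). \<bar>0 + integral {0..x} (w f)\<bar> \<le> 1" for f
        using \<phi>1 by (intro AE_I2) (auto simp: wint space_restrict_space)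
    qed (use char_fun_measurable[OF E] in auto)
    moreover have "graph_integral G len (\<lambda>f x. char_fun E f x * w f x) = (\<integral>x. char_fun E e x * deriv \<phi> x \<partial>edge_measure (len e))"
    proof -
      have "graph_integral G len (\<lambda>f x. char_fun E f x * w f x)
        = (\<Sum>f\<in>arcs G. if f = e then \<integral>x. char_fun E e x * deriv \<phi> x \<partial>edge_measure (len e) else 0)"
        unfolding graph_integral_def by (intro sum.cong) (auto simp: w_def)
      then show ?thesis using e by simp
    qed
    ultimately have "ennreal \<bar>\<integral>x. char_fun E e x * deriv \<phi> x \<partial>edge_measure (len e)\<bar> \<le> Per G len E"
      by (simp add: Per_def)
    then have "\<bar>\<integral>x. char_fun E e x * deriv \<phi> x \<partial>edge_measure (len e)\<bar> \<le> enn2real (Per G len E)"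
      using fin by (metis abs_ge_zero enn2real_ennreal enn2real_mono top.not_eq_extremum)
    then show ?thesis by simp
  qed
  then show "\<exists>C. \<forall>\<phi>. test_fun (len e) \<phi> \<and> (\<forall>x. \<bar>\<phi> x\<bar> \<le> 1) \<longrightarrow>
      (\<integral>x. char_fun E e x * deriv \<phi> x \<partial>edge_measure (len e)) \<le> C" by blast
qed

lemma graph_length_mono:
  assumes "graph_measurable G len A" "graph_measurable G len B" "A \<subseteq> B"
  shows "graph_length G len A \<le> graph_length G len B"
  unfolding graph_length_def graph_integral_def
  using assms by (intro sum_mono integral_mono integrable_char_fun) (auto simp: char_fun_def indicator_def)

lemma Lambda_le_cheeger:
  assumes \<Omega>: "graph_measurable G len \<Omega>" and less: "graph_length G len \<Omega> < graph_length G len (points G len)"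
  shows "Lambda_const G len \<Omega> \<le> cheeger_const G len \<Omega>"
  unfolding cheeger_const_def
proof (rule INF_greatest, safe)
  fix E assume E: "graph_measurable G len E" and sub: "E \<subseteq> \<Omega>" and pos: "0 < graph_length G len E"
  show "Lambda_const G len \<Omega> \<le> Per G len E / ennreal (graph_length G len E)"
  \<comment> \<open>Membership in BV is derived from finite perimeter. If the perimeter is
    \<open>top\<close>, so is the quotient, the length being finite.\<close>
  proof (cases "Per G len E = top")
    case True
    then show ?thesis by (simp add: ennreal_top_divide)
  next
    case False
    have "graph_length G len E < graph_length G len (points G len)"
      using graph_length_mono[OF E \<Omega> sub] less by linarith
    then have "0 < TV G len (char_fun E)" using Per_pos[OF E pos] by (simp add: Per_def)
    moreover have "\<not> graph_AE G len (\<lambda>e x. char_fun E e x = 0)"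
    proof
      assume "graph_AE G len (\<lambda>e x. char_fun E e x = 0)"
      then have "graph_length G len E = 0"
        unfolding graph_length_def graph_integral_def graph_AE_def by (intro sum.neutral ballI integral_eq_zero_AE) auto
      then show False using pos by simp
    qed
    moreover have "graph_AE G len (\<lambda>e x. (e, x) \<notin> \<Omega> \<longrightarrow> char_fun E e x = 0)"
      using sub by (auto simp: graph_AE_def char_fun_def indicator_def)
    moreover have "graph_AE G len (\<lambda>e x. 0 \<le> char_fun E e x)"
      by (auto simp: graph_AE_def char_fun_bounds)
    ultimately have "Lambda_const G len \<Omega> \<le> TV G len (char_fun E) / ennreal (graph_integral G len (char_fun E))"
      unfolding Lambda_const_def using char_fun_BV[OF E False] by (intro INF_lower) auto
    then show ?thesis by (simp add: Per_def graph_length_def)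
  qed
qed

end

section \<open>Superlevel sets\<close>

lemma has_integral_step_cell:
  assumes L: "0 < L" and j: "j < N" and y: "real j * L / real N \<le> y" "y \<le> real (Suc j) * L / real N"
  shows "(step_fun L N b has_integral b j * (y - real j * L / real N)) {real j * L / real N..y}"
proof (rule has_integral_spike_finite)
  show "finite {real j * L / real N, y}" by simp
  fix x assume "x \<in> {real j * L / real N..y} - {real j * L / real N, y}"
  then have "x \<in> cell L N j" using y unfolding cell_def by auto
  then show "step_fun L N b x = b j" by (rule step_fun_cell[OF L j])
next
  show "((\<lambda>x. b j) has_integral b j * (y - real j * L / real N)) {real j * L / real N..y}"
    using has_integral_const_real[of "b j" "real j * L / real N" y] y by (simp add: mult.commute)
qed

lemma has_integral_step_nodes:
  assumes L: "0 < L" and "j \<le> N"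
  shows "(step_fun L N b has_integral (\<Sum>i<j. b i * L / real N)) {0..real j * L / real N}"
  using \<open>j \<le> N\<close>
proof (induction j)
  case (Suc j)
  then have j: "j < N" by simp
  have len: "real (Suc j) * L / real N - real j * L / real N = L / real N" using j by (simp add: field_simps)
  have "(step_fun L N b has_integral b j * (real (Suc j) * L / real N - real j * L / real N))
      {real j * L / real N..real (Suc j) * L / real N}"
    using cell_bounds(3)[OF L j] by (intro has_integral_step_cell L j) auto
  then have "(step_fun L N b has_integral (\<Sum>i<j. b i * L / real N) + b j * (real (Suc j) * L / real N - real j * L / real N))
      {0..real (Suc j) * L / real N}"
    using Suc cell_bounds[OF L j] by (intro has_integral_combine[where c="real j * L / real N"]) auto
  then show ?case unfolding len by simp
qed (simp add: has_integral_refl)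

section \<open>Measure-theoretic tools for superlevel sets\<close>

text \<open>One subsequence has to serve all edges, each with its own measure. It is refined edge by
  edge.\<close>

lemma finite_L1_AE_subseq:
  fixes f :: "'i \<Rightarrow> nat \<Rightarrow> 'a \<Rightarrow> real"
  assumes "finite I" and "\<And>i n. i \<in> I \<Longrightarrow> integrable (M i) (f i n)"
    and "\<And>i. i \<in> I \<Longrightarrow> (\<lambda>n. \<integral>x. \<bar>f i n x\<bar> \<partial>M i) \<longlonglongrightarrow> 0"
  shows "\<exists>r :: nat \<Rightarrow> nat. strict_mono r \<and> (\<forall>i\<in>I. AE x in M i. (\<lambda>n. f i (r n) x) \<longlonglongrightarrow> 0)"
  using assms
proof (induction I rule: finite_induct)
  case empty
  show ?case by (auto intro: exI[of _ id] simp: strict_mono_def)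
next
  case (insert i I)
  then obtain r where r: "strict_mono r" "\<And>j. j \<in> I \<Longrightarrow> AE x in M j. (\<lambda>n. f j (r n) x) \<longlonglongrightarrow> 0"
    by auto
  have "(\<lambda>n. \<integral>x. norm (f i (r n) x) \<partial>M i) \<longlonglongrightarrow> 0"
    using LIMSEQ_subseq_LIMSEQ[OF insert.prems(2)[of i] r(1)] by (simp add: o_def)
  then obtain r' where r': "strict_mono r'" "AE x in M i. (\<lambda>n. f i (r (r' n)) x) \<longlonglongrightarrow> 0"
    using tendsto_L1_AE_subseq[of "M i" "\<lambda>n. f i (r n)"] insert.prems(1) by auto
  have "AE x in M j. (\<lambda>n. f j (r (r' n)) x) \<longlonglongrightarrow> 0" if "j \<in> I" for j
    using r(2)[OF that] by eventually_elim (drule LIMSEQ_subseq_LIMSEQ[OF _ r'(1)], simp add: o_def)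
  then show ?case
    using r' strict_mono_o[OF r(1) r'(1)] by (intro exI[of _ "r \<circ> r'"]) (auto simp: o_def)
qed

text \<open>Tonelli's theorem for the region between 0 and the graph of \<open>u\<close>. The
  section over x has length max 0 (u x), which is also the value of
  \<open>ennreal (u x)\<close>.\<close>

lemma layer_cake:
  fixes u :: "'a \<Rightarrow> real"
  assumes "finite_measure M" and [measurable]: "u \<in> borel_measurable M"
  shows "(\<integral>\<^sup>+t. (\<integral>\<^sup>+x. indicator {0<..<u x} t \<partial>M) \<partial>lborel) = (\<integral>\<^sup>+x. ennreal (u x) \<partial>M)"
    and "(\<lambda>t. \<integral>\<^sup>+x. indicator {0<..<u x} t \<partial>M) \<in> borel_measurable lborel"
proof -
  interpret M: finite_measure M by fact
  interpret P: pair_sigma_finite lborel M ..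
  have [measurable]: "(\<lambda>(t, x). indicator {0<..<u x} t :: ennreal) \<in> borel_measurable (lborel \<Otimes>\<^sub>M M)"
  proof -
    have "(\<lambda>(t, x). indicator {0<..<u x} t :: ennreal) = (\<lambda>p. if 0 < fst p \<and> fst p < u (snd p) then 1 else 0)"
      by (auto simp: indicator_def fun_eq_iff)
    then show ?thesis by simp
  qed
  show "(\<lambda>t. \<integral>\<^sup>+x. indicator {0<..<u x} t \<partial>M) \<in> borel_measurable lborel"
    by measurable
  have "(\<integral>\<^sup>+t. (\<integral>\<^sup>+x. indicator {0<..<u x} t \<partial>M) \<partial>lborel) = (\<integral>\<^sup>+x. (\<integral>\<^sup>+t. indicator {0<..<u x} t \<partial>lborel) \<partial>M)"
    using P.Fubini'[of "\<lambda>t x. indicator {0<..<u x} t"] by simp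
  also have "\<dots> = (\<integral>\<^sup>+x. ennreal (u x) \<partial>M)"
  proof (rule nn_integral_cong)
    fix x
    have "(\<integral>\<^sup>+t. indicator {0<..<u x} t \<partial>lborel) = emeasure lborel {0<..<u x}" by simp
    then show "(\<integral>\<^sup>+t. indicator {0<..<u x} t \<partial>lborel) = ennreal (u x)"
      by (cases "0 \<le> u x") (auto simp: ennreal_neg)
  qed
  finally show "(\<integral>\<^sup>+t. (\<integral>\<^sup>+x. indicator {0<..<u x} t \<partial>M) \<partial>lborel) = (\<integral>\<^sup>+x. ennreal (u x) \<partial>M)" .
qed

text \<open>The exceptional levels are the atoms of the image measure, and a finite measure has only
  countably many.\<close>

lemma AE_level_set_null:
  fixes u :: "'a \<Rightarrow> real"
  assumes "finite_measure M" and [measurable]: "u \<in> borel_measurable M"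
  shows "AE t in lborel. AE x in M. u x \<noteq> t"
proof -
  interpret finite_measure M by fact
  interpret D: finite_measure "distr M borel u" by (rule finite_measure_distr) simp
  have "AE t in lborel. t \<notin> {t. measure (distr M borel u) {t} \<noteq> 0}"
    by (intro AE_not_in countable_imp_null_set_lborel D.countable_support)
  then show ?thesis
  proof eventually_elim
    case (elim t)
    then have "measure M (u -` {t} \<inter> space M) = 0" by (simp add: measure_distr)
    then have "u -` {t} \<inter> space M \<in> null_sets M" by (intro null_setsI) (auto simp: emeasure_eq_measure)
    then show ?case by (rule AE_I') auto
  qed
qed

section \<open>Passage between the graph and its subdivisions\<close>

context connected_metric_graph
begin

text \<open>Interpolate the nodal values linearly. Values in between are convex combinations, so the
  field stays bounded by 1; its slope is constant on cells, so pairing it with \<open>u\<close> only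
  involves the cell averages.\<close>

lemma TV_ge_node_pairing:
  assumes u: "\<And>e. e \<in> arcs G \<Longrightarrow> integrable (edge_measure (len e)) (u e)" and N: "0 < N"
    and s: "node_field N s"
  shows "ennreal \<bar>node_pairing N (\<lambda>e. cell_average (len e) N (u e)) s\<bar> \<le> TV G len u"
proof -
  \<comment> \<open>The slope on cell j: the increment of \<open>s\<close> divided by the cell
    length \<open>len e / N\<close>.\<close>
  define b where "b e j = real N / len e * (s e (Suc j) - s e j)" for e j
  have b: "b e j * len e / real N = s e (Suc j) - s e j" if "e \<in> arcs G" for e j
    using len_pos[OF that] N by (simp add: b_def)
  have nodes: "(step_fun (len e) N (b e) has_integral s e j - s e 0) {0..real j * len e / real N}"
    if "e \<in> arcs G" "j \<le> N" for e j
  proof -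
    have "(\<Sum>i<j. b e i * len e / real N) = s e j - s e 0"
      unfolding b[OF that(1)] by (rule sum_lessThan_telescope)
    then show ?thesis using has_integral_step_nodes[OF len_pos[OF that(1)] that(2), of "b e"] by simp
  qed
  have bound: "\<bar>s e 0 + integral {0..x} (step_fun (len e) N (b e))\<bar> \<le> 1"
    if e: "e \<in> arcs G" and j: "j < N" and x: "x \<in> cell (len e) N j" for e j x
  proof -
    let ?xj = "real j * len e / real N"
    \<comment> \<open>The relative position of x in its cell, which is the interpolation
      parameter.\<close>
    define \<theta> where "\<theta> = (x - ?xj) * real N / len e"
    have L: "0 < len e" by (rule len_pos[OF e])
    have xj: "?xj \<le> x" "x \<le> real (Suc j) * len e / real N" using x by (auto simp: cell_def)
    have "(step_fun (len e) N (b e) has_integral (s e j - s e 0) + b e j * (x - ?xj)) {0..x}"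
      using xj cell_bounds[OF L j] nodes[OF e less_imp_le[OF j]] has_integral_step_cell[OF L j xj, of "b e"]
      by (intro has_integral_combine[where c="?xj"]) auto
    then have "s e 0 + integral {0..x} (step_fun (len e) N (b e)) = s e j + b e j * (x - ?xj)"
      by (simp add: integral_unique)
    also have "\<dots> = (1 - \<theta>) * s e j + \<theta> * s e (Suc j)"
      using L N by (simp add: b_def \<theta>_def field_simps)
    finally have eq: "s e 0 + integral {0..x} (step_fun (len e) N (b e)) = (1 - \<theta>) * s e j + \<theta> * s e (Suc j)" .
    have "real (Suc j) * len e / real N = ?xj + len e / real N" using N by (simp add: field_simps)
    then have "x - ?xj \<le> len e / real N" using xj by linarith
    then have "(x - ?xj) * real N \<le> len e" using N by (simp add: pos_le_divide_eq)
    then have \<theta>: "0 \<le> \<theta>" "\<theta> \<le> 1" using xj L N by (simp_all add: \<theta>_def)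
    have "\<bar>s e j\<bar> \<le> 1" "\<bar>s e (Suc j)\<bar> \<le> 1" using s e j by (auto simp: node_field_def)
    then have "\<bar>(1 - \<theta>) * s e j\<bar> \<le> (1 - \<theta>) * 1" "\<bar>\<theta> * s e (Suc j)\<bar> \<le> \<theta> * 1"
      unfolding abs_mult using \<theta> by (intro mult_mono; simp)+
    then have "\<bar>(1 - \<theta>) * s e j + \<theta> * s e (Suc j)\<bar> \<le> (1 - \<theta>) * 1 + \<theta> * 1"
      by (rule order_trans[OF abs_triangle_ineq add_mono])
    then show ?thesis unfolding eq by simp
  qed
  have "ennreal \<bar>graph_integral G len (\<lambda>e x. u e x * step_fun (len e) N (b e) x)\<bar> \<le> TV G len u"
  proof (rule TV_ge_pairing[where c="\<lambda>e. s e 0" and B="\<lambda>e. \<Sum>j<N. \<bar>b e j\<bar>"])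
    show "u e \<in> borel_measurable (edge_measure (len e))" if "e \<in> arcs G" for e using u[OF that] by simp
    show "step_fun (len e) N (b e) \<in> borel_measurable (edge_measure (len e))" for e
      by (intro borel_measurable_edge step_fun_measurable)
    show "AE x in edge_measure (len e). \<bar>step_fun (len e) N (b e) x\<bar> \<le> (\<Sum>j<N. \<bar>b e j\<bar>)" for e
      by (intro AE_I2 step_fun_bounded)
    show "(\<Sum>e\<in>in_arcs G v. s e 0 + integral {0..len e} (step_fun (len e) N (b e))) = (\<Sum>e\<in>out_arcs G v. s e 0)"
      if v: "v \<in> verts G" for v
    proof -
      have "s e 0 + integral {0..len e} (step_fun (len e) N (b e)) = s e N" if "e \<in> in_arcs G v" for e
        using integral_unique[OF nodes[of e N]] that N by simp
      then show ?thesis using s v by (simp add: node_field_def)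
    qed
    show "AE x in edge_measure (len e). \<bar>s e 0 + integral {0..x} (step_fun (len e) N (b e))\<bar> \<le> 1"
      if "e \<in> arcs G" for e
      using AE_cell[OF len_pos[OF that] N] by eventually_elim (use bound[OF that] in blast)
  qed
  moreover have "graph_integral G len (\<lambda>e x. u e x * step_fun (len e) N (b e) x)
      = node_pairing N (\<lambda>e. cell_average (len e) N (u e)) s"
    unfolding graph_integral_def node_pairing_def
  proof (rule sum.cong[OF refl])
    fix e assume e: "e \<in> arcs G"
    show "(\<integral>x. u e x * step_fun (len e) N (b e) x \<partial>edge_measure (len e))
       = (\<Sum>j<N. cell_average (len e) N (u e) j * (s e (Suc j) - s e j))"
      unfolding integral_mult_step[OF len_pos[OF e] u[OF e]]
      by (intro sum.cong) (auto simp: b_def cell_average_def)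
  qed
  ultimately show ?thesis by simp
qed

text \<open>The converse of interpolation: a cellwise constant function sees a field only through
  its increments between nodes. The negated samples are included because \<open>TV\<close> takes
  absolute values.\<close>

lemma unit_field_nodes:
  assumes z: "z \<in> unit_fields" and N: "0 < N"
  defines "r \<equiv> \<lambda>e j. cont_rep (len e) (z e) (real j * len e / real N)"
  shows "node_field N r" "node_field N (\<lambda>e j. - r e j)"
    and "graph_integral G len (\<lambda>e x. step_fun (len e) N (a e) x * graph_deriv len z e x) = node_pairing N a r"
proof -
  have "\<bar>r e j\<bar> \<le> 1" if "e \<in> arcs G" "j \<le> N" for e j
  proof -
    have "real j * len e \<le> real N * len e" using len_pos[OF that(1)] that(2) by (intro mult_right_mono) auto
    then show ?thesis unfolding r_def using N len_pos[OF that(1)]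
      by (intro unit_fieldD(2)[OF z that(1)]) (auto simp: field_simps)
  qed
  moreover have "(\<Sum>e\<in>in_arcs G v. r e N) = (\<Sum>e\<in>out_arcs G v. r e 0)" if "v \<in> verts G" for v
    using z that N by (auto simp: X_K_def sum_vertex_value r_def)
  ultimately show "node_field N r" "node_field N (\<lambda>e j. - r e j)"
    by (auto simp: node_field_def sum_negf)
  show "graph_integral G len (\<lambda>e x. step_fun (len e) N (a e) x * graph_deriv len z e x) = node_pairing N a r"
    unfolding graph_integral_def node_pairing_def
  proof (rule sum.cong[OF refl])
    fix e assume e: "e \<in> arcs G"
    have "(\<integral>x. step_fun (len e) N (a e) x * graph_deriv len z e x \<partial>edge_measure (len e))
       = (\<Sum>j<N. a e j * cell_integral (len e) N (graph_deriv len z e) j)"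
      using integral_mult_step[OF len_pos[OF e] unit_fieldD(1)[OF z e], of N "a e"] by (simp add: mult.commute)
    also have "\<dots> = (\<Sum>j<N. a e j * (r e (Suc j) - r e j))"
    proof (rule sum.cong[OF refl])
      fix j assume "j \<in> {..<N}"
      then have j: "j < N" by simp
      show "a e j * cell_integral (len e) N (graph_deriv len z e) j = a e j * (r e (Suc j) - r e j)"
        unfolding cell_integral_eq[OF len_pos[OF e] j unit_fieldD(1)[OF z e]] r_def
        using cell_bounds[OF len_pos[OF e] j] by (subst unit_fieldD(3)[OF z e]) auto
    qed
    finally show "(\<integral>x. step_fun (len e) N (a e) x * graph_deriv len z e x \<partial>edge_measure (len e))
       = (\<Sum>j<N. a e j * (r e (Suc j) - r e j))" .
  qed
qed

lemma node_pairing_negate: "node_pairing N a (\<lambda>e j. - r e j) = - node_pairing N a r"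
  by (simp add: node_pairing_def sum_negf[symmetric] algebra_simps)

text \<open>The pairing is linear in the indicators, and the indicator of t < a integrates over t >
  0 to a. Since the single terms carry signs, the sum is integrated as a real function;
  nonnegativity of the whole then allows the passage to \<open>ennreal\<close>.\<close>

lemma nn_integral_superlevel_pairing:
  assumes a: "\<And>e j. e \<in> arcs G \<Longrightarrow> j < N \<Longrightarrow> 0 \<le> a e j"
    and nonneg: "\<And>t. 0 \<le> node_pairing N (\<lambda>e j. of_bool (t < a e j)) s"
  shows "(\<integral>\<^sup>+t. indicator {0<..} t * ennreal (node_pairing N (\<lambda>e j. of_bool (t < a e j)) s) \<partial>lborel)
     = ennreal (node_pairing N a s)"
proof -
  let ?f = "\<lambda>t. \<Sum>e\<in>arcs G. \<Sum>j<N. indicator {0<..<a e j} t * (s e (Suc j) - s e j)"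
  have f: "?f t = indicator {0<..} t * node_pairing N (\<lambda>e j. of_bool (t < a e j)) s" for t :: real
    by (auto simp: node_pairing_def indicator_def sum_distrib_left intro!: sum.cong)
  have "has_bochner_integral lborel ?f (\<Sum>e\<in>arcs G. \<Sum>j<N. a e j * (s e (Suc j) - s e j))"
  proof (intro has_bochner_integral_sum has_bochner_integral_mult_left)
    fix e j assume "e \<in> arcs G" "j \<in> {..<N}"
    then show "has_bochner_integral lborel (indicator {0<..<a e j}) (a e j)"
      using has_bochner_integral_real_indicator[of "{0<..<a e j}" lborel] a[of e j] by simp
  qed
  then have int: "integrable lborel ?f" and eq: "integral\<^sup>L lborel ?f = node_pairing N a s"
    by (auto simp: has_bochner_integral_iff node_pairing_def)
  have "(\<integral>\<^sup>+t. indicator {0<..} t * ennreal (node_pairing N (\<lambda>e j. of_bool (t < a e j)) s) \<partial>lborel)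
     = (\<integral>\<^sup>+t. ennreal (?f t) \<partial>lborel)"
    unfolding f by (intro nn_integral_cong) (auto simp: indicator_def)
  also have "\<dots> = ennreal (integral\<^sup>L lborel ?f)"
  proof (intro nn_integral_eq_integral int)
    show "AE t in lborel. 0 \<le> ?f t" unfolding f using nonneg by simp
  qed
  finally show ?thesis unfolding eq .
qed

end

lemma tendsto_of_bool_less:
  fixes v :: "nat \<Rightarrow> real"
  assumes "v \<longlonglongrightarrow> l" "l \<noteq> t"
  shows "(\<lambda>n. of_bool (t < v n) :: real) \<longlonglongrightarrow> of_bool (t < l)"
proof (cases "t < l")
  case True
  then show ?thesis
    using order_tendstoD(1)[OF assms(1) True] by (intro tendsto_eventually) (auto elim!: eventually_mono)
next
  case False
  then have "l < t" using assms(2) by simp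
  then show ?thesis
    using order_tendstoD(2)[OF assms(1)] by (intro tendsto_eventually) (fastforce elim!: eventually_mono)
qed

context connected_metric_graph
begin

lemma cheeger_le_quotient:
  assumes \<Omega>: "graph_measurable G len \<Omega>"
    and BV: "u \<in> graph_BV G len"
    and off: "graph_AE G len (\<lambda>e x. (e, x) \<notin> \<Omega> \<longrightarrow> u e x = 0)"
    and nonneg: "graph_AE G len (\<lambda>e x. 0 \<le> u e x)"
    and TV_pos: "0 < TV G len u"
  shows "cheeger_const G len \<Omega> \<le> TV G len u / ennreal (graph_integral G len u)"
proof -
  let ?h = "cheeger_const G len \<Omega>"
  let ?M = "\<lambda>e. edge_measure (len e)"
  have ui: "integrable (?M e) (u e)" if "e \<in> arcs G" for e
    using BV that by (auto simp: graph_BV_def BV_fun_def)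
  then have um: "u e \<in> borel_measurable (?M e)" if "e \<in> arcs G" for e using that by auto
  have u0: "AE x in ?M e. 0 \<le> u e x" if "e \<in> arcs G" for e
    using nonneg that by (auto simp: graph_AE_def)
  have uoff: "AE x in ?M e. (e, x) \<notin> \<Omega> \<longrightarrow> u e x = 0" if "e \<in> arcs G" for e
    using off that by (auto simp: graph_AE_def)
  \<comment> \<open>The shift to \<open>Suc n\<close> keeps the subdivision nonempty, as the
    calibrating field requires.\<close>
  define a where "a n e = cell_average (len e) (Suc n) (u e)" for n e
  have a0: "0 \<le> a n e j" if "e \<in> arcs G" for n e j
  proof -
    have "0 \<le> cell_integral (len e) (Suc n) (u e) j"
      unfolding cell_integral_def using u0[OF that] by (intro integral_nonneg_AE) (auto elim!: eventually_mono)
    then show ?thesis using len_pos[OF that] by (simp add: a_def cell_average_def)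
  qed
  have "\<forall>n. \<exists>s. node_field (Suc n) s \<and> (\<forall>t r. node_field (Suc n) r \<longrightarrow>
    node_pairing (Suc n) (\<lambda>e j. of_bool (t < a n e j)) r \<le> node_pairing (Suc n) (\<lambda>e j. of_bool (t < a n e j)) s)"
    by (intro allI exists_calibrating_field)
  from choice[OF this] obtain s where s: "\<And>n. node_field (Suc n) (s n)"
    and opt: "\<And>n t r. node_field (Suc n) r \<Longrightarrow>
      node_pairing (Suc n) (\<lambda>e j. of_bool (t < a n e j)) r \<le> node_pairing (Suc n) (\<lambda>e j. of_bool (t < a n e j)) (s n)"
    by blast
  \<comment> \<open>The perimeter of the superlevel set of the averaged function relative to the
    subdivision, attained by the same \<open>s n\<close> for every t. It is nonnegative because the
    zero field competes.\<close>
  define \<Phi> where "\<Phi> n t = node_pairing (Suc n) (\<lambda>e j. of_bool (t < a n e j)) (s n)" for n t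
  have \<Phi>0: "0 \<le> \<Phi> n t" for n t
    using opt[of n "\<lambda>_ _. 0" t] by (simp add: \<Phi>_def node_field_def node_pairing_def)
  have \<Phi>_le_TV: "(\<integral>\<^sup>+t. indicator {0<..} t * ennreal (\<Phi> n t) \<partial>lborel) \<le> TV G len u" for n
  proof -
    have "(\<integral>\<^sup>+t. indicator {0<..} t * ennreal (\<Phi> n t) \<partial>lborel) = ennreal (node_pairing (Suc n) (a n) (s n))"
      unfolding \<Phi>_def using a0 \<Phi>0[of n] by (intro nn_integral_superlevel_pairing) (auto simp: \<Phi>_def)
    also have "\<dots> \<le> ennreal \<bar>node_pairing (Suc n) (a n) (s n)\<bar>" by (intro ennreal_leI) simp
    also have "\<dots> \<le> TV G len u" unfolding a_def by (intro TV_ge_node_pairing ui s) auto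
    finally show ?thesis .
  qed
  have \<Phi>_meas: "(\<lambda>t. indicator {0<..} t * ennreal (\<Phi> n t)) \<in> borel_measurable lborel" for n
    unfolding \<Phi>_def node_pairing_def of_bool_def by measurable
  define lev where "lev n t e = step_fun (len e) (Suc n) (\<lambda>j. of_bool (t < a n e j))" for n t e
  \<comment> \<open>Sampling an admissible field at the nodes gives a competitor for
    \<open>s n\<close>; applying optimality to the samples and their negatives yields the absolute
    value.\<close>
  have lev_le: "\<bar>graph_integral G len (\<lambda>e x. lev n t e x * graph_deriv len z e x)\<bar> \<le> \<Phi> n t"
    if z: "z \<in> unit_fields" for n t z
    unfolding lev_def unit_field_nodes(3)[OF z zero_less_Suc] \<Phi>_def abs_le_iff
    using opt[OF unit_field_nodes(1)[OF z zero_less_Suc]] opt[OF unit_field_nodes(2)[OF z zero_less_Suc]]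
    unfolding node_pairing_negate by blast
  have "\<exists>r :: nat \<Rightarrow> nat. strict_mono r \<and>
    (\<forall>e\<in>arcs G. AE x in ?M e. (\<lambda>n. step_fun (len e) (Suc (r n)) (a (r n) e) x - u e x) \<longlonglongrightarrow> 0)"
    unfolding a_def using ui
    by (intro finite_L1_AE_subseq LIMSEQ_Suc[OF cell_average_tendsto_L1[OF len_pos]]) auto
  then obtain r :: "nat \<Rightarrow> nat" where r: "\<And>e. e \<in> arcs G \<Longrightarrow>
      AE x in ?M e. (\<lambda>n. step_fun (len e) (Suc (r n)) (a (r n) e) x - u e x) \<longlonglongrightarrow> 0"
    by blast
  \<comment> \<open>The restriction to \<Omega> makes \<open>E t\<close> an honest subset although
    \<open>u\<close> vanishes off \<Omega> only almost everywhere. For t > 0 this changes the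
    superlevel set by a null set.\<close>
  define E where "E t = {(e, x) \<in> \<Omega>. t < u e x}" for t
  have E: "graph_measurable G len (E t)" for t
    unfolding graph_measurable_def
  proof (intro conjI ballI)
    show "E t \<subseteq> points G len" using \<Omega> by (auto simp: E_def graph_measurable_def)
    fix e assume e: "e \<in> arcs G"
    have "{x \<in> space (?M e). t < u e x} \<in> sets (?M e)" using um[OF e] by measurable
    then have "{x \<in> {0<..<len e}. t < u e x} \<in> sets lebesgue"
      by (simp add: sets_restrict_space_iff space_restrict_space)
    moreover have "{x. (e, x) \<in> \<Omega>} \<in> sets lebesgue" using \<Omega> e by (auto simp: graph_measurable_def)
    moreover have "{x. (e, x) \<in> E t} = {x. (e, x) \<in> \<Omega>} \<inter> {x \<in> {0<..<len e}. t < u e x}"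
      using \<Omega> by (auto simp: E_def graph_measurable_def points_def)
    ultimately show "{x. (e, x) \<in> E t} \<in> sets lebesgue" by auto
  qed
  have E_AE: "AE x in ?M e. char_fun (E t) e x = of_bool (t < u e x)" if "e \<in> arcs G" "0 < t" for e t
    using uoff[OF that(1)] by eventually_elim (use that(2) in \<open>auto simp: char_fun_def E_def\<close>)
  \<comment> \<open>Lower semicontinuity: for one fixed field the pairings converge, dominated by
    the absolute value of its derivative, and each is bounded by \<Phi>. The supremum over fields is
    taken only afterwards.\<close>
  have Per_le: "Per G len (E t) \<le> liminf (\<lambda>n. ennreal (\<Phi> (r n) t))"
    if t: "0 < t" and level: "\<And>e. e \<in> arcs G \<Longrightarrow> AE x in ?M e. u e x \<noteq> t" for t
    unfolding Per_def TV_def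
  proof (rule SUP_least)
    fix z assume z: "z \<in> unit_fields"
    let ?I = "\<lambda>n. graph_integral G len (\<lambda>e x. lev n t e x * graph_deriv len z e x)"
    have "(\<lambda>n. ?I (r n)) \<longlonglongrightarrow> graph_integral G len (\<lambda>e x. char_fun (E t) e x * graph_deriv len z e x)"
      unfolding graph_integral_def
    proof (rule tendsto_sum)
      fix e assume e: "e \<in> arcs G"
      note zi = unit_fieldD(1)[OF z e]
      have cells: "AE x in ?M e. \<forall>n. \<exists>j<Suc n. x \<in> cell (len e) (Suc n) j"
        unfolding AE_all_countable by (intro allI AE_cell len_pos[OF e]) simp
      have lev_eq: "AE x in ?M e. \<forall>n. lev n t e x = of_bool (t < step_fun (len e) (Suc n) (a n e) x)"
        using cells
      proof eventually_elim
        case (elim x)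
        show ?case
        proof
          fix n
          obtain j where "j < Suc n" "x \<in> cell (len e) (Suc n) j" using elim by blast
          then show "lev n t e x = of_bool (t < step_fun (len e) (Suc n) (a n e) x)"
            using step_fun_cell[OF len_pos[OF e]] by (simp add: lev_def)
        qed
      qed
      show "(\<lambda>n. \<integral>x. lev (r n) t e x * graph_deriv len z e x \<partial>?M e)
        \<longlonglongrightarrow> (\<integral>x. char_fun (E t) e x * graph_deriv len z e x \<partial>?M e)"
      proof (rule integral_dominated_convergence[where w="\<lambda>x. \<bar>graph_deriv len z e x\<bar>"])
        show "AE x in ?M e. (\<lambda>n. lev (r n) t e x * graph_deriv len z e x) \<longlonglongrightarrow> char_fun (E t) e x * graph_deriv len z e x"
          using lev_eq r[OF e] level[OF e] E_AE[OF e t]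
        proof eventually_elim
          case (elim x)
          have "(\<lambda>n. step_fun (len e) (Suc (r n)) (a (r n) e) x) \<longlonglongrightarrow> u e x"
            using elim(2) by (simp add: LIM_zero_iff)
          from tendsto_of_bool_less[OF this elim(3)] have "(\<lambda>n. lev (r n) t e x) \<longlonglongrightarrow> char_fun (E t) e x"
            using elim(1,4) by simp
          then show ?case by (intro tendsto_intros)
        qed
        show "AE x in ?M e. norm (lev (r n) t e x * graph_deriv len z e x) \<le> \<bar>graph_deriv len z e x\<bar>" for n
          using lev_eq by eventually_elim (auto simp: abs_mult of_bool_def)
        have "lev n t e \<in> borel_measurable (?M e)" for n
          unfolding lev_def by (intro borel_measurable_edge step_fun_measurable)
        then show "(\<lambda>x. lev (r n) t e x * graph_deriv len z e x) \<in> borel_measurable (?M e)" for n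
          using zi by (intro borel_measurable_times) auto
      qed (use zi char_fun_measurable[OF E e] in auto)
    qed
    then have "(\<lambda>n. ennreal \<bar>?I (r n)\<bar>) \<longlonglongrightarrow> ennreal \<bar>graph_integral G len (\<lambda>e x. char_fun (E t) e x * graph_deriv len z e x)\<bar>"
      by (intro tendsto_ennrealI tendsto_rabs)
    then have "ennreal \<bar>graph_integral G len (\<lambda>e x. char_fun (E t) e x * graph_deriv len z e x)\<bar> = liminf (\<lambda>n. ennreal \<bar>?I (r n)\<bar>)"
      by (intro lim_imp_Liminf[symmetric]) auto
    also have "\<dots> \<le> liminf (\<lambda>n. ennreal (\<Phi> (r n) t))"
      by (intro Liminf_mono always_eventually allI ennreal_leI lev_le[OF z])
    finally show "ennreal \<bar>graph_integral G len (\<lambda>e x. char_fun (E t) e x * graph_deriv len z e x)\<bar>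
      \<le> liminf (\<lambda>n. ennreal (\<Phi> (r n) t))" .
  qed
  \<comment> \<open>The length of {u > t} for t > 0 and 0 otherwise, in the form that
    \<open>layer_cake\<close> integrates over t.\<close>
  define superlen where "superlen t = (\<Sum>e\<in>arcs G. \<integral>\<^sup>+x. indicator {0<..<u e x} t \<partial>?M e)" for t
  have length_E: "ennreal (graph_length G len (E t)) = superlen t" if t: "0 < t" for t
  proof -
    have "ennreal (graph_length G len (E t)) = (\<Sum>e\<in>arcs G. ennreal (\<integral>x. char_fun (E t) e x \<partial>?M e))"
      unfolding graph_length_def graph_integral_def
      by (intro sum_ennreal[symmetric] Bochner_Integration.integral_nonneg char_fun_bounds)
    also have "\<dots> = superlen t"
      unfolding superlen_def
    proof (rule sum.cong[OF refl])
      fix e assume e: "e \<in> arcs G"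
      have "ennreal (\<integral>x. char_fun (E t) e x \<partial>?M e) = (\<integral>\<^sup>+x. ennreal (char_fun (E t) e x) \<partial>?M e)"
        by (intro nn_integral_eq_integral[symmetric] integrable_char_fun E e AE_I2 char_fun_bounds)
      also have "\<dots> = (\<integral>\<^sup>+x. indicator {0<..<u e x} t \<partial>?M e)"
        using E_AE[OF e t] t by (intro nn_integral_cong_AE) (auto elim!: eventually_mono simp: indicator_def)
      finally show "ennreal (\<integral>x. char_fun (E t) e x \<partial>?M e) = (\<integral>\<^sup>+x. indicator {0<..<u e x} t \<partial>?M e)" .
    qed
    finally show ?thesis .
  qed
  have h_le: "?h * superlen t \<le> liminf (\<lambda>n. indicator {0<..} t * ennreal (\<Phi> (r n) t))"
    if level: "\<And>e. e \<in> arcs G \<Longrightarrow> AE x in ?M e. u e x \<noteq> t" for t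
  proof (cases "0 < t \<and> 0 < graph_length G len (E t)")
    case True
    then have t: "0 < t" and pos: "0 < graph_length G len (E t)" by auto
    let ?l = "ennreal (graph_length G len (E t))"
    have "?h \<le> Per G len (E t) / ?l"
      unfolding cheeger_const_def using E pos by (intro INF_lower) (auto simp: E_def)
    then have "?h * ?l \<le> Per G len (E t) / ?l * ?l" by (rule mult_right_mono) simp
    also have "\<dots> = Per G len (E t)"
      using pos by (simp add: ennreal_divide_times)
    also have "\<dots> \<le> liminf (\<lambda>n. ennreal (\<Phi> (r n) t))" by (rule Per_le[OF t level])
    finally show ?thesis using t by (simp add: length_E)
  next
    \<comment> \<open>The left-hand side is then 0 even if the Cheeger constant is infinite, because
      the product of \<open>top\<close> and 0 is 0.\<close>
    case False
    have "superlen t = 0"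
    proof (cases "0 < t")
      case True
      then show ?thesis using False length_E[of t, symmetric] by (simp add: ennreal_neg not_less)
    next
      case False
      then show ?thesis by (simp add: superlen_def)
    qed
    then show ?thesis by simp
  qed
  have superlen_meas: "(\<lambda>t. \<integral>\<^sup>+x. indicator {0<..<u e x} t \<partial>?M e) \<in> borel_measurable lborel" if "e \<in> arcs G" for e
    by (intro layer_cake(2) um that finite_measure_edge)
  have "ennreal (graph_integral G len u) = (\<Sum>e\<in>arcs G. ennreal (\<integral>x. u e x \<partial>?M e))"
    unfolding graph_integral_def using u0 by (intro sum_ennreal[symmetric] integral_nonneg_AE)
  also have "\<dots> = (\<Sum>e\<in>arcs G. \<integral>\<^sup>+x. ennreal (u e x) \<partial>?M e)"
    by (intro sum.cong refl nn_integral_eq_integral[symmetric] ui u0)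
  also have "\<dots> = (\<Sum>e\<in>arcs G. \<integral>\<^sup>+t. (\<integral>\<^sup>+x. indicator {0<..<u e x} t \<partial>?M e) \<partial>lborel)"
    by (intro sum.cong refl layer_cake(1)[symmetric] um finite_measure_edge)
  also have "\<dots> = (\<integral>\<^sup>+t. superlen t \<partial>lborel)"
    unfolding superlen_def by (intro nn_integral_sum[symmetric] superlen_meas)
  finally have cake: "ennreal (graph_integral G len u) = (\<integral>\<^sup>+t. superlen t \<partial>lborel)" .
  have "?h * ennreal (graph_integral G len u) = (\<integral>\<^sup>+t. ?h * superlen t \<partial>lborel)"
    unfolding cake superlen_def by (intro nn_integral_cmult[symmetric] borel_measurable_sum superlen_meas)
  also have "\<dots> \<le> (\<integral>\<^sup>+t. liminf (\<lambda>n. indicator {0<..} t * ennreal (\<Phi> (r n) t)) \<partial>lborel)"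
  proof (rule nn_integral_mono_AE)
    have "AE t in lborel. \<forall>e\<in>arcs G. AE x in ?M e. u e x \<noteq> t"
      by (intro AE_finite_allI AE_level_set_null um finite_measure_edge) auto
    then show "AE t in lborel. ?h * superlen t \<le> liminf (\<lambda>n. indicator {0<..} t * ennreal (\<Phi> (r n) t))"
      by eventually_elim (rule h_le, blast)
  qed
  also have "\<dots> \<le> liminf (\<lambda>n. \<integral>\<^sup>+t. indicator {0<..} t * ennreal (\<Phi> (r n) t) \<partial>lborel)"
    by (intro nn_integral_liminf \<Phi>_meas)
  also have "\<dots> \<le> liminf (\<lambda>n. TV G len u)"
    by (intro Liminf_mono always_eventually allI \<Phi>_le_TV)
  also have "\<dots> = TV G len u" by (simp add: Liminf_const)
  finally have le: "?h * ennreal (graph_integral G len u) \<le> TV G len u" .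
  show ?thesis
  proof (cases "ennreal (graph_integral G len u) = 0")
    \<comment> \<open>In \<open>ennreal\<close> a positive number divided by 0 is
      \<open>top\<close>, so the bound is trivial.\<close>
    case True
    then show ?thesis using TV_pos by simp
  next
    case False
    then have "?h = ?h * ennreal (graph_integral G len u) / ennreal (graph_integral G len u)"
      by (simp add: ennreal_mult_divide_eq)
    also have "\<dots> \<le> TV G len u / ennreal (graph_integral G len u)"
      by (rule divide_right_mono_ennreal[OF le])
    finally show ?thesis .
  qed
qed

end

theorem theorem3p4:
  fixes G :: "('v, 'e) pre_digraph" and len :: "'e \<Rightarrow> real" and \<Omega> :: "('e \<times> real) set"
  assumes "connected_metric_graph G len"
    and "graph_measurable G len \<Omega>"
    and "0 < graph_length G len \<Omega>"
    and "graph_length G len \<Omega> < graph_length G len (points G len)"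
  shows "cheeger_const G len \<Omega> = Lambda_const G len \<Omega>"
proof (rule antisym)
  interpret connected_metric_graph G len by fact
  show "Lambda_const G len \<Omega> \<le> cheeger_const G len \<Omega>"
    using assms by (intro Lambda_le_cheeger)
  show "cheeger_const G len \<Omega> \<le> Lambda_const G len \<Omega>"
    unfolding Lambda_const_def
    by (rule INF_greatest) (auto intro!: cheeger_le_quotient assms)
qed

end
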